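(* Let $n\ge 2$ be an integer and $\ell=\lfloor\frac{n-2}{2}\rfloor$. Let $Q=\mathsf{k}[x_1,\dots,x_n]$, where $\mathsf{k}$ is a field with $\operatorname{char}\mathsf{k}=0$ or $\operatorname{char}\mathsf{k}>n$, and let $J=(x_1^2,\dots,x_n^2)$ and $G=J:(x_1+\dots+x_n)^2$. Then $$G=\begin{cases} J+\big((x_1-x_2)(x_3-x_4)\cdots(x_{n-2}-x_{n-1})\big)_{\mathfrak{S}_n}, & n \text{ odd},\\ J+\big((x_1-x_2)(x_3-x_4)\cdots(x_{n-3}-x_{n-2})\,x_{n-1}\big)_{\mathfrak{S}_n}, & n\text{ even},\end{cases}$$ and the initial ideal of $G$ with respect to the reverse lexicographic order $>$ with $x_1>x_2>\dots>x_n$ is $$\operatorname{in}_>(G)=J+\big(x_{i_1}x_{i_2}\cdots x_{i_{\ell+1}} \;\big|\; 0<i_1<\dots<i_{\ell+1},\ i_j\le 2j \text{ for all } 1\le j\le \ell+1\big).$$ In particular, $G$ has a Gröbner basis (with respect to $>$) whose elements lie in the same degrees as the minimal generators of $G$.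
   Context: The symmetric group $\mathfrak{S}_n$ acts on $Q$ by permuting variables, $\sigma\cdot f(x_1,\dots,x_n)=f(x_{\sigma(1)},\dots,x_{\sigma(n)})$, and for $f\in Q$, $(f)_{\mathfrak{S}_n}$ denotes the ideal $(\sigma\cdot f\mid \sigma\in\mathfrak{S}_n)$. For $n=2$ the product $(x_1-x_2)\cdots(x_{n-3}-x_{n-2})$ is empty, so the displayed element is $x_1$. The reverse lexicographic order is the graded (degree) reverse lexicographic monomial order. *)

theory Defs
  imports
    "HOL-Library.Poly_Mapping"
    "HOL-Combinatorics.Permutations"
    "HOL-Algebra.Ideal"
begin

text \<open>
  A monomial is its exponent vector, a finitely supported function \<open>nat \<Rightarrow>\<^sub>0 nat\<close>; a polynomial maps
  monomials to coefficients. The type has variables indexed by all of \<open>nat\<close>; the polynomial ring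
  in \<open>x\<^sub>1, \<dots>, x\<^sub>n\<close> is the subring of those polynomials in which only these variables occur, and all
  ideals below are ideals of that ring.
\<close>

type_synonym monomial = "nat \<Rightarrow>\<^sub>0 nat"
type_synonym 'a mpoly = "monomial \<Rightarrow>\<^sub>0 'a"

definition Var :: "nat \<Rightarrow> 'a::comm_ring_1 mpoly" where
  "Var i = Poly_Mapping.single (Poly_Mapping.single i 1) 1"

definition mpoly_ring :: "nat \<Rightarrow> 'a::comm_ring_1 mpoly ring" where
  "mpoly_ring n =
    \<lparr> carrier = {f. \<forall>m \<in> Poly_Mapping.keys f. Poly_Mapping.keys m \<subseteq> {1..n}},
      mult = (*), one = 1, zero = 0, add = (+) \<rparr>"

definition colon :: "('a, 'b) ring_scheme \<Rightarrow> 'a set \<Rightarrow> 'a \<Rightarrow> 'a set" where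
  "colon R I s = {f \<in> carrier R. f \<otimes>\<^bsub>R\<^esub> s \<in> I}"


subsection \<open>The action of the symmetric group\<close>

definition subst_mpoly :: "(nat \<Rightarrow> 'a mpoly) \<Rightarrow> 'a mpoly \<Rightarrow> 'a::comm_ring_1 mpoly" where
  "subst_mpoly g f =
    (\<Sum>m \<in> Poly_Mapping.keys f. Poly_Mapping.single 0 (Poly_Mapping.lookup f m) *
       (\<Prod>i \<in> Poly_Mapping.keys m. g i ^ Poly_Mapping.lookup m i))"

definition perm_act :: "(nat \<Rightarrow> nat) \<Rightarrow> 'a mpoly \<Rightarrow> 'a::comm_ring_1 mpoly" where
  "perm_act \<sigma> f = subst_mpoly (\<lambda>i. Var (\<sigma> i)) f"

definition sym_ideal :: "nat \<Rightarrow> 'a mpoly \<Rightarrow> 'a::comm_ring_1 mpoly set" where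
  "sym_ideal n f = Idl\<^bsub>mpoly_ring n\<^esub> {perm_act \<sigma> f | \<sigma>. \<sigma> permutes {1..n}}"


subsection \<open>Degree reverse lexicographic order and initial ideals\<close>

definition mono_degree :: "monomial \<Rightarrow> nat" where
  "mono_degree m = (\<Sum>i \<in> Poly_Mapping.keys m. Poly_Mapping.lookup m i)"

text \<open>
  With equal degrees, the smaller monomial is the one with the larger exponent at the last position
  where the two differ; in particular \<open>x\<^sub>1 > x\<^sub>2 > \<dots> > x\<^sub>n\<close>.
\<close>

definition grevlex_less :: "monomial \<Rightarrow> monomial \<Rightarrow> bool" where
  "grevlex_less s t \<longleftrightarrow>
     mono_degree s < mono_degree t \<or>
     mono_degree s = mono_degree t \<and>
       (\<exists>i. Poly_Mapping.lookup s i > Poly_Mapping.lookup t i \<and>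
            (\<forall>j>i. Poly_Mapping.lookup s j = Poly_Mapping.lookup t j))"

definition lead_monomial :: "'a::zero mpoly \<Rightarrow> monomial" where
  "lead_monomial f = (THE t. t \<in> Poly_Mapping.keys f \<and>
     (\<forall>s \<in> Poly_Mapping.keys f. s \<noteq> t \<longrightarrow> grevlex_less s t))"

definition lead_ideal :: "nat \<Rightarrow> 'a::comm_ring_1 mpoly set \<Rightarrow> 'a mpoly set" where
  "lead_ideal n S = Idl\<^bsub>mpoly_ring n\<^esub> {Poly_Mapping.single (lead_monomial f) 1 | f. f \<in> S \<and> f \<noteq> 0}"

abbreviation initial_ideal :: "nat \<Rightarrow> 'a::comm_ring_1 mpoly set \<Rightarrow> 'a mpoly set" where
  "initial_ideal n I \<equiv> lead_ideal n I"

definition groebner_basis :: "nat \<Rightarrow> 'a::comm_ring_1 mpoly set \<Rightarrow> 'a mpoly set \<Rightarrow> bool" where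
  "groebner_basis n B I \<longleftrightarrow>
     finite B \<and> B \<subseteq> I \<and> 0 \<notin> B \<and> lead_ideal n B = initial_ideal n I"


subsection \<open>Degrees and minimal generators\<close>

definition mpoly_degree :: "'a::zero mpoly \<Rightarrow> nat" where
  "mpoly_degree f = Max (mono_degree ` Poly_Mapping.keys f)"

definition homogeneous :: "'a::zero mpoly \<Rightarrow> bool" where
  "homogeneous f \<longleftrightarrow> (\<forall>m \<in> Poly_Mapping.keys f. mono_degree m = mpoly_degree f)"

text \<open>Minimal generators of a homogeneous ideal are, as usual, taken to be homogeneous.\<close>

definition minimal_generators :: "nat \<Rightarrow> 'a::comm_ring_1 mpoly set \<Rightarrow> 'a mpoly set \<Rightarrow> bool" where
  "minimal_generators n M I \<longleftrightarrow>
     M \<subseteq> carrier (mpoly_ring n) \<and> (\<forall>f \<in> M. homogeneous f) \<and>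
     Idl\<^bsub>mpoly_ring n\<^esub> M = I \<and> (\<forall>M'. M' \<subset> M \<longrightarrow> Idl\<^bsub>mpoly_ring n\<^esub> M' \<noteq> I)"


subsection \<open>Basic facts\<close>

lemma mpoly_ring_simps [simp]:
  "mult (mpoly_ring n) = (*)" "one (mpoly_ring n) = 1"
  "zero (mpoly_ring n) = 0" "add (mpoly_ring n) = (+)"
  by (simp_all add: mpoly_ring_def)

lemma in_carrier_mpoly_ring:
  "f \<in> carrier (mpoly_ring n) \<longleftrightarrow> (\<forall>m \<in> Poly_Mapping.keys f. Poly_Mapping.keys m \<subseteq> {1..n})"
  by (simp add: mpoly_ring_def)

lemma cring_mpoly_ring: "cring (mpoly_ring n :: 'a::comm_ring_1 mpoly ring)"
proof (rule cringI)
  have add: "f + g \<in> carrier (mpoly_ring n)"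
    if "f \<in> carrier (mpoly_ring n)" "g \<in> carrier (mpoly_ring n)" for f g :: "'a mpoly"
    using that Poly_Mapping.keys_add[of f g] unfolding in_carrier_mpoly_ring by blast
  have mult: "f * g \<in> carrier (mpoly_ring n)"
    if "f \<in> carrier (mpoly_ring n)" "g \<in> carrier (mpoly_ring n)" for f g :: "'a mpoly"
    unfolding in_carrier_mpoly_ring
  proof
    fix m assume "m \<in> Poly_Mapping.keys (f * g)"
    then obtain a b where ab: "m = a + b" "a \<in> Poly_Mapping.keys f" "b \<in> Poly_Mapping.keys g"
      using Poly_Mapping.keys_mult[of f g] by blast
    have "Poly_Mapping.keys m \<subseteq> Poly_Mapping.keys a \<union> Poly_Mapping.keys b"
      unfolding ab(1) by (rule Poly_Mapping.keys_add)
    with ab that show "Poly_Mapping.keys m \<subseteq> {1..n}"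
      unfolding in_carrier_mpoly_ring by blast
  qed
  show "abelian_group (mpoly_ring n :: 'a mpoly ring)"
  proof (rule abelian_groupI; simp?)
    show "\<exists>g \<in> carrier (mpoly_ring n). g + f = 0"
      if "f \<in> carrier (mpoly_ring n)" for f :: "'a mpoly"
      using that by (intro bexI[of _ "- f"]) (auto simp: in_carrier_mpoly_ring)
  qed (auto simp: algebra_simps intro: add, simp add: in_carrier_mpoly_ring)
  show "Group.comm_monoid (mpoly_ring n :: 'a mpoly ring)"
    by (rule comm_monoidI)
      (auto simp: mult algebra_simps, simp add: in_carrier_mpoly_ring flip: single_one)
qed (simp add: algebra_simps)

lemma grevlex_less_irrefl: "\<not> grevlex_less s s"
  by (simp add: grevlex_less_def)

lemma grevlex_less_trans:
  assumes "grevlex_less s t" "grevlex_less t u"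
  shows "grevlex_less s u"
proof (cases "mono_degree s < mono_degree t \<or> mono_degree t < mono_degree u")
  case True
  then show ?thesis using assms unfolding grevlex_less_def by auto
next
  case False
  then obtain i j where
    i: "Poly_Mapping.lookup s i > Poly_Mapping.lookup t i"
       "\<forall>k>i. Poly_Mapping.lookup s k = Poly_Mapping.lookup t k" and
    j: "Poly_Mapping.lookup t j > Poly_Mapping.lookup u j"
       "\<forall>k>j. Poly_Mapping.lookup t k = Poly_Mapping.lookup u k" and
    deg: "mono_degree s = mono_degree u"
    using assms unfolding grevlex_less_def by auto
  have "Poly_Mapping.lookup s (max i j) > Poly_Mapping.lookup u (max i j)"
    using i j by (cases i j rule: linorder_cases) (auto simp: max_def)
  moreover have "\<forall>k>max i j. Poly_Mapping.lookup s k = Poly_Mapping.lookup u k"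
    using i j by auto
  ultimately show ?thesis using deg unfolding grevlex_less_def by blast
qed

lemma grevlex_less_linear:
  assumes "s \<noteq> t"
  shows "grevlex_less s t \<or> grevlex_less t s"
proof -
  let ?D = "{i. Poly_Mapping.lookup s i \<noteq> Poly_Mapping.lookup t i}"
  have "?D \<subseteq> Poly_Mapping.keys s \<union> Poly_Mapping.keys t"
    by (auto simp: Poly_Mapping.in_keys_iff)
  then have fin: "finite ?D" by (rule finite_subset) simp
  have ne: "?D \<noteq> {}" using assms by (auto intro: poly_mapping_eqI)
  have "Max ?D \<in> ?D" using fin ne by (rule Max_in)
  moreover have "\<forall>j>Max ?D. Poly_Mapping.lookup s j = Poly_Mapping.lookup t j"
    using fin Max_ge[of ?D] by (metis (mono_tags, lifting) leD mem_Collect_eq)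
  ultimately show ?thesis unfolding grevlex_less_def
    by (metis (mono_tags, lifting) linorder_neqE_nat mem_Collect_eq)
qed

lemma lead_monomial_props:
  assumes "f \<noteq> 0"
  shows "lead_monomial f \<in> Poly_Mapping.keys f"
    and "\<forall>s \<in> Poly_Mapping.keys f. s \<noteq> lead_monomial f \<longrightarrow> grevlex_less s (lead_monomial f)"
proof -
  have ex: "\<exists>t \<in> A. \<forall>s \<in> A. s \<noteq> t \<longrightarrow> grevlex_less s t" if "finite A" "A \<noteq> {}" for A
    using that
  proof (induction A rule: finite_ne_induct)
    case (insert x F)
    then obtain t where t: "t \<in> F" "\<forall>s \<in> F. s \<noteq> t \<longrightarrow> grevlex_less s t" by blast
    have "x \<noteq> t" using insert.hyps t by blast
    then consider "grevlex_less x t" | "grevlex_less t x" using grevlex_less_linear by blast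
    then show ?case
    proof cases
      case 1
      then show ?thesis using t by blast
    next
      case 2
      then have "\<forall>s \<in> insert x F. s \<noteq> x \<longrightarrow> grevlex_less s x"
        using t(2) by (metis grevlex_less_trans insertE)
      then show ?thesis by blast
    qed
  qed simp
  obtain t where t: "t \<in> Poly_Mapping.keys f"
    "\<forall>s \<in> Poly_Mapping.keys f. s \<noteq> t \<longrightarrow> grevlex_less s t"
    using ex[of "Poly_Mapping.keys f"] assms by auto
  have "u = t" if "u \<in> Poly_Mapping.keys f"
    "\<forall>s \<in> Poly_Mapping.keys f. s \<noteq> u \<longrightarrow> grevlex_less s u" for u
    using that t grevlex_less_trans[of t u t] grevlex_less_irrefl[of t] by metis
  with t have "\<exists>!t. t \<in> Poly_Mapping.keys f \<and>
      (\<forall>s \<in> Poly_Mapping.keys f. s \<noteq> t \<longrightarrow> grevlex_less s t)"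
    by blast
  from theI'[OF this] show "lead_monomial f \<in> Poly_Mapping.keys f"
    and "\<forall>s \<in> Poly_Mapping.keys f. s \<noteq> lead_monomial f \<longrightarrow> grevlex_less s (lead_monomial f)"
    unfolding lead_monomial_def by blast+
qed

end

theory Submission
  imports Defs "HOL-Library.Infinite_Set"
begin

text \<open>
  Write \<open>s = x\<^sub>1 + \<dots> + x\<^sub>n\<close> and \<open>x\<^sub>S\<close> for the product of the variables in \<open>S\<close>. Modulo the squares a
  polynomial is the same as a family of coefficients \<open>a S\<close>, one for each set \<open>S \<subseteq> {1..n}\<close>, and \<open>f\<close> lies
  in \<open>G\<close> iff the class of \<open>f\<close> is annihilated by \<open>s\<^sup>2\<close>.

  The upper bound for the initial ideal is a sharp form of the strong Lefschetz property. Read \<open>S\<close> as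
  a lattice path that goes up at the positions in \<open>S\<close> and down elsewhere. If \<open>s\<^sup>r\<close> kills a nonzero class
  whose leading squarefree monomial is \<open>x\<^sub>S\<close>, then the path of \<open>S\<close> stays above height \<open>-r\<close>
  (\<open>revlex_leading_ballot\<close>). The induction on \<open>n\<close> writes the class as \<open>g + x\<^sub>n h\<close> with \<open>g, h\<close> free of
  \<open>x\<^sub>n\<close>. If \<open>g = 0\<close>, the path of \<open>h\<close> is extended by an up-step. If \<open>g \<noteq> 0\<close>, the leading monomial is
  that of \<open>g\<close>, and the only danger is a final down-step to height exactly \<open>-r\<close>; but then the bound for
  \<open>n - 1\<close>, applied to \<open>h\<close> with \<open>s\<^sup>r\<^sup>+\<^sup>1\<close> and afterwards to \<open>g\<close> with \<open>s\<^sup>r\<^sup>-\<^sup>1\<close>, forces \<open>h = 0\<close> and \<open>g = 0\<close>.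
  Here the characteristic enters: \<open>r \<le> n\<close> has to be invertible. For \<open>r = 2\<close> the
  sets that survive are those whose first \<open>l + 1\<close> elements satisfy \<open>i\<^sub>j \<le> 2j\<close>.

  For the lower bound, every such sequence \<open>i\<^sub>1 < \<dots> < i\<^sub>l\<^sub>+\<^sub>1\<close> can be matched with larger elements outside
  of it: its \<open>j\<close>-th element is smaller than the \<open>(j+1)\<close>-st element of the complement (for even \<open>n\<close> the last
  element stays unmatched, because the complement is exhausted). The corresponding
  product of differences is a permuted generator whose leading monomial is the product of the \<open>x\<close> with index in
  the sequence (\<open>spec_poly_lead\<close>), and it lies in \<open>G\<close> because each factor \<open>x - y\<close> kills \<open>x + y\<close> modulo squares, so
  that \<open>s\<close> may be replaced by the sum of at most two variables (\<open>spec_poly_colon\<close>).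

  So the ideal generated by the squares and the permuted generators is contained in \<open>G\<close> and has the same
  leading monomials, hence it is \<open>G\<close> (\<open>ideal_subset_if_leads\<close>). The degrees of minimal homogeneous
  generators of an ideal depend only on the ideal (\<open>minimal_generators_degrees\<close>): they are the degrees
  in which forms of lower degree do not generate everything. For \<open>G\<close> these include the degree \<open>l + 1\<close>
  of the products, and degree \<open>2\<close> when \<open>n \<ge> 3\<close>; for \<open>n = 2\<close> the squares are multiples of \<open>x\<^sub>1\<close> and \<open>x\<^sub>2\<close>. A
  minimal generating set, enlarged by the products and, when \<open>n \<ge> 3\<close>, the squares, is therefore a
  Groebner basis in the right degrees.
\<close>

section \<open>Powers of the sum of the variables on squarefree monomials\<close>

text \<open>Multiplication by the sum of the variables: if \<open>a S\<close> is the coefficient of \<open>x\<^sub>S\<close> in \<open>f\<close>, then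
  \<open>lower_sum a T\<close> is the coefficient of \<open>x\<^sub>T\<close> in \<open>f\<close> times that sum. The number of variables does not
  occur in it, which makes the induction on \<open>n\<close> below possible with one operator.\<close>
definition lower_sum :: "(nat set \<Rightarrow> 'a::comm_ring_1) \<Rightarrow> nat set \<Rightarrow> 'a" where
  "lower_sum a T = (\<Sum>i\<in>T. a (T - {i}))"

text \<open>Agrees with the reverse lexicographic order on squarefree monomials of equal degree: the smaller
  set is the one that contains the largest element in which the two differ.\<close>
definition revlex_less :: "nat set \<Rightarrow> nat set \<Rightarrow> bool" where
  "revlex_less S S' \<longleftrightarrow> (\<exists>i. i \<in> S \<and> i \<notin> S' \<and> (\<forall>j>i. j \<in> S \<longleftrightarrow> j \<in> S'))"

lemma lower_sum_pow_Suc: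
  "(lower_sum ^^ Suc r) a T = (\<Sum>i\<in>T. (lower_sum ^^ r) a (T - {i}))"
  by (simp add: lower_sum_def)

text \<open>The \<open>r\<close>-th power only sees the coefficients of the subsets with \<open>r\<close> elements fewer.\<close>
lemma lower_sum_pow_vanish:
  assumes "finite T" "\<And>S. S \<subseteq> T \<Longrightarrow> card S + r = card T \<Longrightarrow> a S = 0"
  shows "(lower_sum ^^ r) a T = 0"
  using assms
proof (induction r arbitrary: T)
  case (Suc r)
  have "(lower_sum ^^ r) a (T - {i}) = 0" if "i \<in> T" for i
  proof (rule Suc.IH)
    have "card T > 0" using that Suc.prems(1) by (auto simp: card_gt_0_iff)
    then show "a S = 0" if "S \<subseteq> T - {i}" "card S + r = card (T - {i})" for S
      using that \<open>i \<in> T\<close> Suc.prems(1) Suc.prems(2)[of S] by auto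
  qed (use Suc.prems in auto)
  then show ?case by (simp add: lower_sum_pow_Suc del: funpow.simps)
qed simp

text \<open>The binomial expansion of \<open>(s + x\<^sub>n)\<^sup>r\<close> stops after two terms because \<open>x\<^sub>n\<^sup>2 = 0\<close>.\<close>
lemma lower_sum_pow_insert:
  assumes "finite T" "n \<notin> T"
  shows "(lower_sum ^^ r) a (insert n T) =
    (lower_sum ^^ r) (\<lambda>S. a (insert n S)) T + of_nat r * (lower_sum ^^ (r - 1)) a T"
  using assms
proof (induction r arbitrary: T)
  case (Suc r)
  let ?h = "\<lambda>S. a (insert n S)"
  have IH: "(lower_sum ^^ r) a (insert n T - {i}) =
      (lower_sum ^^ r) ?h (T - {i}) + of_nat r * (lower_sum ^^ (r - 1)) a (T - {i})"
    if "i \<in> T" for i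
  proof -
    have "insert n T - {i} = insert n (T - {i})" using that Suc.prems by auto
    then show ?thesis using Suc.IH[of "T - {i}"] Suc.prems by simp
  qed
  have r: "of_nat r * (\<Sum>i\<in>T. (lower_sum ^^ (r - 1)) a (T - {i})) =
      of_nat r * (lower_sum ^^ r) a T"
    by (cases r) (simp_all add: lower_sum_pow_Suc del: funpow.simps)
  have "(lower_sum ^^ Suc r) a (insert n T) =
      (lower_sum ^^ r) a (insert n T - {n}) + (\<Sum>i\<in>T. (lower_sum ^^ r) a (insert n T - {i}))"
    using Suc.prems by (simp add: lower_sum_pow_Suc del: funpow.simps)
  also have "insert n T - {n} = T" using Suc.prems by auto
  also have "(\<Sum>i\<in>T. (lower_sum ^^ r) a (insert n T - {i})) =
      (\<Sum>i\<in>T. (lower_sum ^^ r) ?h (T - {i}) + of_nat r * (lower_sum ^^ (r - 1)) a (T - {i}))"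
    by (intro sum.cong refl IH)
  also have "\<dots> = (\<Sum>i\<in>T. (lower_sum ^^ r) ?h (T - {i})) +
      of_nat r * (\<Sum>i\<in>T. (lower_sum ^^ (r - 1)) a (T - {i}))"
    by (simp only: sum.distrib sum_distrib_left)
  also have "\<dots> = (lower_sum ^^ Suc r) ?h T + of_nat r * (lower_sum ^^ r) a T"
    by (simp only: r lower_sum_pow_Suc)
  finally show ?case by (simp add: algebra_simps del: funpow.simps)
qed simp

lemma revlex_irrefl: "\<not> revlex_less S S"
  by (auto simp: revlex_less_def)

lemma revlex_trans:
  assumes "revlex_less S T" "revlex_less T U" shows "revlex_less S U"
proof -
  from assms obtain i j where ij: "i \<in> S" "i \<notin> T" "\<forall>k>i. k \<in> S \<longleftrightarrow> k \<in> T"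
     "j \<in> T" "j \<notin> U" "\<forall>k>j. k \<in> T \<longleftrightarrow> k \<in> U"
    unfolding revlex_less_def by auto
  consider "i < j" | "j < i" using ij(2,4) by (cases i j rule: linorder_cases) auto
  then show ?thesis
  proof cases
    case 1
    then have "j \<in> S" "j \<notin> U" "\<forall>k>j. k \<in> S \<longleftrightarrow> k \<in> U" using ij by auto
    then show ?thesis unfolding revlex_less_def by blast
  next
    case 2
    then have "i \<in> S" "i \<notin> U" "\<forall>k>i. k \<in> S \<longleftrightarrow> k \<in> U" using ij by auto
    then show ?thesis unfolding revlex_less_def by blast
  qed
qed

lemma exists_revlex_leading:
  assumes "finite A" "A \<noteq> {}" "\<And>S. S \<in> A \<Longrightarrow> finite S"
  shows "\<exists>S\<in>A. \<forall>S'\<in>A. \<not> revlex_less S S'"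
  using assms
proof (induction A rule: finite_ne_induct)
  case (singleton x)
  then show ?case by (simp add: revlex_irrefl)
next
  case (insert x F)
  then obtain S where S: "S \<in> F" "\<forall>S'\<in>F. \<not> revlex_less S S'" by auto
  show ?case
  proof (cases "revlex_less S x")
    case True
    have "\<not> revlex_less x S'" if "S' \<in> insert x F" for S'
      using that True S revlex_trans[OF True] revlex_irrefl by auto
    then show ?thesis by blast
  next
    case False
    then show ?thesis using S by blast
  qed
qed

text \<open>The sharp Lefschetz bound: \<open>2 * card (S \<inter> {1..i}) - i\<close> is the height of the path of \<open>S\<close> after \<open>i\<close>
  steps, and it exceeds \<open>-r\<close> at every \<open>i\<close>. At \<open>i = n\<close> this contains the strong Lefschetz property: if
  \<open>2 * d + r \<le> n\<close>, then no nonzero class of degree \<open>d\<close> is killed by \<open>s\<^sup>r\<close>. The induction step uses this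
  consequence in \<open>n\<close> variables for the exponents \<open>r + 1\<close> and \<open>r - 1\<close>, which is why \<open>r\<close> and \<open>d\<close> vary.\<close>
lemma revlex_leading_ballot:
  fixes a :: "nat set \<Rightarrow> 'a::field"
  assumes "\<And>m. 0 < m \<Longrightarrow> m \<le> n \<Longrightarrow> (of_nat m :: 'a) \<noteq> 0"
    and "\<And>T. T \<subseteq> {1..n} \<Longrightarrow> card T = d + r \<Longrightarrow> (lower_sum ^^ r) a T = 0"
    and "S \<subseteq> {1..n}" "card S = d" "a S \<noteq> 0"
    and "\<And>S'. S' \<subseteq> {1..n} \<Longrightarrow> card S' = d \<Longrightarrow> revlex_less S S' \<Longrightarrow> a S' = 0"
    and "i \<le> n"
  shows "i < 2 * card (S \<inter> {1..i}) + r"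
  using assms
proof (induction n arbitrary: r d a S i)
  case 0
  then have "S = {}" "d = 0" "i = 0" by auto
  moreover have "r \<noteq> 0" using 0 by (metis add_0_right funpow_0)
  ultimately show ?case by simp
next
  case (Suc n)
  let ?h = "\<lambda>S. a (insert (Suc n) S)"
  have rpos: "r > 0" using Suc.prems(2)[of S] Suc.prems(3-5) by (cases r) auto
  have sub: "T \<subseteq> {1..Suc n}" if "T \<subseteq> {1..n}" for T using that by auto
  have fin: "finite T" "Suc n \<notin> T" if "T \<subseteq> {1..n}" for T
    using that finite_subset by auto
  have char: "(of_nat m :: 'a) \<noteq> 0" if "0 < m" "m \<le> n" for m using Suc.prems(1) that by simp
  \<comment> \<open>The coefficient of \<open>s\<^sup>r\<close> times the class at a set that contains \<open>n + 1\<close>.\<close>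
  have split: "(lower_sum ^^ r) ?h T + of_nat r * (lower_sum ^^ (r - 1)) a T = 0"
    if "T \<subseteq> {1..n}" "card T + 1 = d + r" for T
    using Suc.prems(2)[of "insert (Suc n) T"] that fin[OF that(1)]
      sub[OF that(1)]
    by (simp add: lower_sum_pow_insert card_insert_if)
  show ?case
  proof (cases "Suc n \<in> S")
    case True
    define S0 where "S0 = S - {Suc n}"
    have S: "S = insert (Suc n) S0" "Suc n \<notin> S0" using True S0_def by auto
    have S0: "S0 \<subseteq> {1..n}" using Suc.prems(3) S0_def by (auto simp: le_Suc_eq)
    have d: "d = Suc (card S0)" using S Suc.prems(4) fin[OF S0] by simp
    have zero: "a S' = 0" if "S' \<subseteq> {1..n}" "card S' = d" for S'
      using that True Suc.prems(6)[of S'] sub[of S'] Suc.prems(3) unfolding revlex_less_def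
      by (metis atLeastAtMost_iff fin(2) not_less subset_iff)
    \<comment> \<open>Every set without \<open>n + 1\<close> exceeds \<open>S\<close>, so the class is divisible by the last variable.\<close>
    have h0: "(lower_sum ^^ r) ?h T = 0" if "T \<subseteq> {1..n}" "card T = card S0 + r" for T
    proof -
      have "(lower_sum ^^ (r - 1)) a T = 0"
        using that rpos by (intro lower_sum_pow_vanish fin zero) (auto simp: d)
      then show ?thesis using split[of T] that d by simp
    qed
    have IH: "i < 2 * card (S0 \<inter> {1..i}) + r" if "i \<le> n" for i
    proof (rule Suc.IH[of "card S0" r ?h])
      show "?h S' = 0" if S': "S' \<subseteq> {1..n}" "card S' = card S0" "revlex_less S0 S'" for S'
      proof (rule Suc.prems(6))
        show "insert (Suc n) S' \<subseteq> {1..Suc n}" using S' by auto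
        show "card (insert (Suc n) S') = d" using S' fin[of S'] d by simp
        obtain j where "j \<in> S0" "j \<notin> S'" "\<forall>k>j. k \<in> S0 \<longleftrightarrow> k \<in> S'"
          using S'(3) unfolding revlex_less_def by auto
        then show "revlex_less S (insert (Suc n) S')"
          unfolding revlex_less_def S(1) using S(2) by (intro exI[of _ j]) auto
      qed
      show "?h S0 \<noteq> 0" using S(1) Suc.prems(5) by simp
    qed (use char h0 S0 that in simp_all)
    show ?thesis
    proof (cases "i \<le> n")
      case True
      then have "S \<inter> {1..i} = S0 \<inter> {1..i}" using S by auto
      then show ?thesis using IH[OF True] by simp
    next
      case False
      then have i: "i = Suc n" using Suc.prems(7) by simp
      then have "S \<inter> {1..i} = S" "S0 \<inter> {1..n} = S0" using Suc.prems(3) S0 by auto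
      then show ?thesis using IH[of n] d Suc.prems(4) i by simp
    qed
  next
    case False
    have S: "S \<subseteq> {1..n}" using Suc.prems(3) False by (auto simp: le_Suc_eq)
    have IH: "i < 2 * card (S \<inter> {1..i}) + r" if "i \<le> n" for i
      using char Suc.prems(2)[OF sub] S Suc.prems(4,5) Suc.prems(6)[OF sub] that
      by (rule Suc.IH[of d r a])
    have cS: "S \<inter> {1..n} = S" "S \<inter> {1..Suc n} = S" using S by auto
    \<comment> \<open>Only a last step from height \<open>1 - r\<close> down to \<open>-r\<close> has to be excluded.\<close>
    have "Suc n \<noteq> 2 * d + r"
    proof
      assume eq: "Suc n = 2 * d + r"
      \<comment> \<open>The relation \<open>s\<^sup>r h = - r s\<^sup>r\<^sup>-\<^sup>1 g\<close> and \<open>s\<^sup>r g = 0\<close> give \<open>s\<^sup>r\<^sup>+\<^sup>1 h = 0\<close>, in a degree in which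
         \<open>s\<^sup>r\<^sup>+\<^sup>1\<close> is injective.\<close>
      have h: "?h U = 0" if U: "U \<subseteq> {1..n}" "Suc (card U) = d" for U
      proof (rule ccontr)
        assume "?h U \<noteq> 0"
        let ?A = "{U. U \<subseteq> {1..n} \<and> Suc (card U) = d \<and> ?h U \<noteq> 0}"
        have "\<exists>U\<in>?A. \<forall>U'\<in>?A. \<not> revlex_less U U'"
          by (rule exists_revlex_leading) (use U \<open>?h U \<noteq> 0\<close> fin in auto)
        then obtain V where V: "V \<in> ?A" "\<And>U'. U' \<in> ?A \<Longrightarrow> \<not> revlex_less V U'" by blast
        have "n < 2 * card (V \<inter> {1..n}) + Suc r"
        proof (rule Suc.IH[of "card V" "Suc r" ?h])
          show "(lower_sum ^^ Suc r) ?h T = 0" if T: "T \<subseteq> {1..n}" "card T = card V + Suc r" for T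
          proof -
            have "(lower_sum ^^ r) ?h (T - {i}) = - (of_nat r * (lower_sum ^^ (r - 1)) a (T - {i}))"
              if "i \<in> T" for i
              using split[of "T - {i}"] T V(1) that
              by (auto simp: card_Diff_singleton eq_neg_iff_add_eq_0)
            then have "(lower_sum ^^ Suc r) ?h T =
                - (of_nat r * (\<Sum>i\<in>T. (lower_sum ^^ (r - 1)) a (T - {i})))"
              by (simp add: lower_sum_pow_Suc sum_negf sum_distrib_left del: funpow.simps)
            also have "(\<Sum>i\<in>T. (lower_sum ^^ (r - 1)) a (T - {i})) = (lower_sum ^^ r) a T"
              using rpos lower_sum_pow_Suc[of "r - 1" a T] by simp
            also have "\<dots> = 0" using Suc.prems(2)[of T] T V(1) sub by auto
            finally show ?thesis by simp
          qed
          show "?h S' = 0" if "S' \<subseteq> {1..n}" "card S' = card V" "revlex_less V S'" for S'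
            using V(1) V(2)[of S'] that by auto
        qed (use char V(1) in simp_all)
        moreover have "V \<inter> {1..n} = V" using V(1) by auto
        ultimately show False using V(1) eq by auto
      qed
      \<comment> \<open>With \<open>h = 0\<close> the same relation gives \<open>s\<^sup>r\<^sup>-\<^sup>1 g = 0\<close>, provided that \<open>r\<close> is invertible.\<close>
      have a0: "(lower_sum ^^ (r - 1)) a T = 0" if "T \<subseteq> {1..n}" "card T = d + (r - 1)" for T
      proof -
        have "(lower_sum ^^ r) ?h T = 0"
        proof (intro lower_sum_pow_vanish fin that(1))
          show "?h U = 0" if "U \<subseteq> T" "card U + r = card T" for U
            using h[of U] that \<open>T \<subseteq> {1..n}\<close> \<open>card T = d + (r - 1)\<close> rpos by auto
        qed
        moreover have "(of_nat r :: 'a) \<noteq> 0" using Suc.prems(1)[of r] rpos eq by simp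
        ultimately show ?thesis using split[of T] that rpos by simp
      qed
      have "n < 2 * card (S \<inter> {1..n}) + (r - 1)"
        using char a0 S Suc.prems(4,5) Suc.prems(6)[OF sub] order_refl
        by (rule Suc.IH[of d "r - 1" a])
      then show False using cS eq Suc.prems(4) rpos by simp
    qed
    then show ?thesis using IH[of i] IH[of n] cS Suc.prems(4,7)
      by (cases "i \<le> n") (auto simp: le_Suc_eq)
  qed
qed

section \<open>Leading monomials of products\<close>

lemma mpoly_sum_monomials:
  fixes f :: "'b \<Rightarrow>\<^sub>0 'a::comm_monoid_add"
  shows "f = (\<Sum>m\<in>Poly_Mapping.keys f. Poly_Mapping.single m (Poly_Mapping.lookup f m))"
  by (rule poly_mapping_eqI)
    (simp add: lookup_sum lookup_single when_def Poly_Mapping.in_keys_iff)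

text \<open>The steps may overlap with monomials already present, so this is suited to additive properties
  only, but then it carries no side conditions.\<close>
lemma mpoly_induct [case_names zero add]:
  fixes f :: "'b \<Rightarrow>\<^sub>0 'a::comm_monoid_add"
  assumes "P 0" "\<And>f m c. P f \<Longrightarrow> P (f + Poly_Mapping.single m c)"
  shows "P f"
proof -
  have "P (\<Sum>m\<in>A. Poly_Mapping.single m (Poly_Mapping.lookup f m))" if "finite A" for A
    using that
  proof (induction A)
    case (insert m A)
    then show ?case using assms(2)[OF insert.IH] by (simp add: add.commute)
  qed (simp add: assms(1))
  from this[OF finite_keys[of f]] show ?thesis using mpoly_sum_monomials[of f] by simp
qed

text \<open>Monomials can be cancelled, so only one term of \<open>f\<close> contributes.\<close>
lemma lookup_times_single:
  fixes f :: "'a::comm_ring_1 mpoly"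
  shows "Poly_Mapping.lookup (f * Poly_Mapping.single u c) (v + u) = Poly_Mapping.lookup f v * c"
  by (induction f rule: mpoly_induct)
    (simp_all add: distrib_right Poly_Mapping.lookup_add Poly_Mapping.mult_single Poly_Mapping.lookup_single when_def)

lemma lookup_times_single_eq_0:
  fixes f :: "'a::comm_ring_1 mpoly"
  assumes "\<And>v. t \<noteq> v + u"
  shows "Poly_Mapping.lookup (f * Poly_Mapping.single u c) t = 0"
  by (induction f rule: mpoly_induct)
    (use assms in \<open>auto simp: distrib_right Poly_Mapping.lookup_add Poly_Mapping.mult_single Poly_Mapping.lookup_single when_def\<close>)

lemma mono_degree_eq_sum:
  assumes "finite A" "Poly_Mapping.keys m \<subseteq> A"
  shows "mono_degree m = (\<Sum>i\<in>A. Poly_Mapping.lookup m i)"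
  unfolding mono_degree_def
  by (rule sum.mono_neutral_left) (use assms in \<open>auto simp: Poly_Mapping.in_keys_iff\<close>)

lemma mono_degree_add: "mono_degree (s + t) = mono_degree s + mono_degree t"
proof -
  let ?A = "Poly_Mapping.keys s \<union> Poly_Mapping.keys t"
  have "mono_degree u = (\<Sum>i\<in>?A. Poly_Mapping.lookup u i)" if "u \<in> {s, t, s + t}" for u
    using that Poly_Mapping.keys_add[of s t] by (intro mono_degree_eq_sum) auto
  then show ?thesis by (simp add: Poly_Mapping.lookup_add sum.distrib)
qed

lemma mono_degree_single [simp]: "mono_degree (Poly_Mapping.single i k) = k"
  by (simp add: mono_degree_def)

lemma grevlex_less_add: "grevlex_less (s + u) (t + u) \<longleftrightarrow> grevlex_less s t"
  by (simp add: grevlex_less_def mono_degree_add Poly_Mapping.lookup_add)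

text \<open>Unlike \<open>lead_monomial\<close>, this relation passes to products over any commutative ring: the leading
  coefficient being \<open>1\<close>, no zero divisors can interfere.\<close>
definition monic_at :: "monomial \<Rightarrow> 'a::comm_ring_1 mpoly \<Rightarrow> bool" where
  "monic_at t f \<longleftrightarrow> Poly_Mapping.lookup f t = 1 \<and> (\<forall>u\<in>Poly_Mapping.keys f. u \<noteq> t \<longrightarrow> grevlex_less u t)"

lemma monic_at_lead:
  assumes "monic_at t f" shows "f \<noteq> 0" "lead_monomial f = t"
proof -
  show "f \<noteq> 0" using assms by (auto simp: monic_at_def)
  from lead_monomial_props[OF this] assms grevlex_less_trans grevlex_less_irrefl
  show "lead_monomial f = t"
    unfolding monic_at_def by (metis Poly_Mapping.in_keys_iff zero_neq_one)
qed

lemma monic_at_single: "monic_at t (Poly_Mapping.single t 1)"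
  by (simp add: monic_at_def)

text \<open>The order is compatible with multiplication, so every product of two terms other than the two
  leading ones is strictly smaller than the product of these.\<close>
lemma monic_at_mult:
  assumes f: "monic_at t f" and g: "monic_at u g"
  shows "monic_at (t + u) (f * g)"
proof -
  define f' where "f' = f - Poly_Mapping.single t 1"
  define g' where "g' = g - Poly_Mapping.single u 1"
  have f': "grevlex_less s t" if "s \<in> Poly_Mapping.keys f'" for s
    using that f unfolding monic_at_def f'_def
    by (cases "s = t") (auto simp: Poly_Mapping.in_keys_iff Poly_Mapping.lookup_minus Poly_Mapping.lookup_single)
  have g': "grevlex_less s u" if "s \<in> Poly_Mapping.keys g'" for s
    using that g unfolding monic_at_def g'_def
    by (cases "s = u") (auto simp: Poly_Mapping.in_keys_iff Poly_Mapping.lookup_minus Poly_Mapping.lookup_single)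
  have less_add: "grevlex_less (a + b) (t + u)"
    if "a = t \<or> grevlex_less a t" "b = u \<or> grevlex_less b u" "\<not> (a = t \<and> b = u)" for a b
    using that grevlex_less_add[of a b t] grevlex_less_add[of b t u]
      grevlex_less_trans[of "a + b" "t + b" "t + u"] by (auto simp: add.commute)
  define r where "r = Poly_Mapping.single t 1 * g' + f' * Poly_Mapping.single u 1 + f' * g'"
  have eq: "f * g = Poly_Mapping.single (t + u) 1 + r"
    unfolding r_def f'_def g'_def by (simp add: algebra_simps Poly_Mapping.mult_single)
  have r: "grevlex_less s (t + u)" if s: "s \<in> Poly_Mapping.keys r" for s
  proof -
    have "s \<in> Poly_Mapping.keys (Poly_Mapping.single t 1 * g') \<union> Poly_Mapping.keys (f' * Poly_Mapping.single u 1) \<union> Poly_Mapping.keys (f' * g')"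
      using s Poly_Mapping.keys_add[of "Poly_Mapping.single t 1 * g' + f' * Poly_Mapping.single u 1" "f' * g'"]
        Poly_Mapping.keys_add[of "Poly_Mapping.single t 1 * g'" "f' * Poly_Mapping.single u 1"] unfolding r_def by blast
    moreover have irr: "t \<notin> Poly_Mapping.keys f'" "u \<notin> Poly_Mapping.keys g'"
      using f' g' grevlex_less_irrefl by blast+
    ultimately obtain a b where "s = a + b" "a = t \<or> a \<in> Poly_Mapping.keys f'" "b = u \<or> b \<in> Poly_Mapping.keys g'"
      "\<not> (a = t \<and> b = u)"
      using Poly_Mapping.keys_mult[of "Poly_Mapping.single t 1" g'] Poly_Mapping.keys_mult[of f' "Poly_Mapping.single u 1"]
        Poly_Mapping.keys_mult[of f' g'] by (fastforce split: if_splits)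
    then show ?thesis using f' g' less_add by blast
  qed
  then have "t + u \<notin> Poly_Mapping.keys r" using grevlex_less_irrefl by blast
  then have "Poly_Mapping.lookup (f * g) (t + u) = 1"
    unfolding eq by (simp add: Poly_Mapping.lookup_add Poly_Mapping.in_keys_iff)
  moreover have "grevlex_less s (t + u)" if "s \<in> Poly_Mapping.keys (f * g)" "s \<noteq> t + u" for s
    using that r[of s] unfolding eq
    by (auto simp: Poly_Mapping.in_keys_iff Poly_Mapping.lookup_add Poly_Mapping.lookup_single when_def)
  ultimately show ?thesis by (simp add: monic_at_def)
qed

lemma monic_at_prod:
  assumes "finite A" "\<And>i. i \<in> A \<Longrightarrow> monic_at (t i) (f i)"
  shows "monic_at (\<Sum>i\<in>A. t i) (\<Prod>i\<in>A. f i)"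
  using assms
proof (induction A)
  case empty
  then show ?case using monic_at_single[of 0] by simp
qed (simp add: monic_at_mult)

section \<open>Ideals of the polynomial ring\<close>

lemma keys_Var: "m \<in> Poly_Mapping.keys (Var i :: 'a::comm_ring_1 mpoly) \<longleftrightarrow> m = Poly_Mapping.single i 1"
  by (simp add: Var_def)

lemma Var_carrier: "i \<in> {1..n} \<Longrightarrow> Var i \<in> carrier (mpoly_ring n)"
  by (simp add: in_carrier_mpoly_ring Var_def)

lemma single_carrier:
  "Poly_Mapping.keys m \<subseteq> {1..n} \<Longrightarrow> Poly_Mapping.single m c \<in> carrier (mpoly_ring n)"
  by (simp add: in_carrier_mpoly_ring)

lemma carrier_mpoly_add:
  "f \<in> carrier (mpoly_ring n) \<Longrightarrow> g \<in> carrier (mpoly_ring n) \<Longrightarrow>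
    f + g \<in> carrier (mpoly_ring n :: 'a::comm_ring_1 mpoly ring)"
  using cring.cring_simprules(1)[OF cring_mpoly_ring, of f n g] by simp

lemma carrier_mpoly_mult:
  "f \<in> carrier (mpoly_ring n) \<Longrightarrow> g \<in> carrier (mpoly_ring n) \<Longrightarrow>
    f * g \<in> carrier (mpoly_ring n :: 'a::comm_ring_1 mpoly ring)"
  using cring.cring_simprules(5)[OF cring_mpoly_ring, of f n g] by simp

lemma carrier_mpoly_0: "0 \<in> carrier (mpoly_ring n :: 'a::comm_ring_1 mpoly ring)"
  by (simp add: in_carrier_mpoly_ring)

lemma carrier_mpoly_1: "1 \<in> carrier (mpoly_ring n :: 'a::comm_ring_1 mpoly ring)"
  using cring.cring_simprules(6)[OF cring_mpoly_ring, of n] by simp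

lemma carrier_mpoly_uminus:
  "f \<in> carrier (mpoly_ring n) \<Longrightarrow> - f \<in> carrier (mpoly_ring n :: 'a::comm_ring_1 mpoly ring)"
  by (auto simp: in_carrier_mpoly_ring)

lemma carrier_mpoly_diff:
  "f \<in> carrier (mpoly_ring n) \<Longrightarrow> g \<in> carrier (mpoly_ring n) \<Longrightarrow>
    f - g \<in> carrier (mpoly_ring n :: 'a::comm_ring_1 mpoly ring)"
  using carrier_mpoly_add[of f n "- g"] carrier_mpoly_uminus[of g n] by simp

lemma carrier_mpoly_sum:
  "(\<And>i. i \<in> A \<Longrightarrow> f i \<in> carrier (mpoly_ring n)) \<Longrightarrow>
    (\<Sum>i\<in>A. f i) \<in> carrier (mpoly_ring n :: 'a::comm_ring_1 mpoly ring)"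
  by (induction A rule: infinite_finite_induct) (auto intro: carrier_mpoly_add carrier_mpoly_0)

lemma carrier_mpoly_prod:
  "(\<And>i. i \<in> A \<Longrightarrow> f i \<in> carrier (mpoly_ring n)) \<Longrightarrow>
    (\<Prod>i\<in>A. f i) \<in> carrier (mpoly_ring n :: 'a::comm_ring_1 mpoly ring)"
  by (induction A rule: infinite_finite_induct) (auto intro: carrier_mpoly_mult carrier_mpoly_1)

lemma carrier_mpoly_power:
  "f \<in> carrier (mpoly_ring n) \<Longrightarrow> f ^ k \<in> carrier (mpoly_ring n :: 'a::comm_ring_1 mpoly ring)"
  by (induction k) (auto intro: carrier_mpoly_mult carrier_mpoly_1)

text \<open>Negation is multiplication by the constant \<open>-1\<close>, so closure under it is automatic.\<close>
lemma ideal_mpolyI: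
  fixes I :: "'a::comm_ring_1 mpoly set"
  assumes sub: "I \<subseteq> carrier (mpoly_ring n)" and zero: "0 \<in> I"
    and add: "\<And>f g. f \<in> I \<Longrightarrow> g \<in> I \<Longrightarrow> f + g \<in> I"
    and mult: "\<And>a f. a \<in> carrier (mpoly_ring n) \<Longrightarrow> f \<in> I \<Longrightarrow> a * f \<in> I"
  shows "ideal I (mpoly_ring n)"
proof -
  interpret R: cring "mpoly_ring n :: 'a mpoly ring" by (rule cring_mpoly_ring)
  have neg: "\<ominus>\<^bsub>mpoly_ring n\<^esub> f \<in> I" if "f \<in> I" for f
  proof -
    have "(-1) * f \<in> I" using that by (intro mult carrier_mpoly_uminus carrier_mpoly_1)
    moreover have "\<ominus>\<^bsub>mpoly_ring n\<^esub> f = - f"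
      using that sub by (intro R.minus_equality) (auto intro: carrier_mpoly_uminus)
    ultimately show ?thesis by simp
  qed
  show ?thesis
  proof (rule idealI)
    show "subgroup I (add_monoid (mpoly_ring n))"
    proof (rule R.add.subgroupI)
      show "\<ominus>\<^bsub>mpoly_ring n\<^esub> f \<in> I" if "f \<in> I" for f
        using neg[OF that] .
    qed (use sub zero add in auto)
    show "f \<otimes>\<^bsub>mpoly_ring n\<^esub> a \<in> I" if "f \<in> I" "a \<in> carrier (mpoly_ring n)" for a f
      using mult[OF that(2,1)] by (simp add: mult.commute)
  qed (use mult R.ring_axioms in auto)
qed

lemma ideal_mpolyD:
  fixes I :: "'a::comm_ring_1 mpoly set"
  assumes "ideal I (mpoly_ring n)"
  shows "I \<subseteq> carrier (mpoly_ring n)" "0 \<in> I"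
    "\<And>f g. f \<in> I \<Longrightarrow> g \<in> I \<Longrightarrow> f + g \<in> I"
    "\<And>a f. a \<in> carrier (mpoly_ring n) \<Longrightarrow> f \<in> I \<Longrightarrow> a * f \<in> I"
    "\<And>a f. a \<in> carrier (mpoly_ring n) \<Longrightarrow> f \<in> I \<Longrightarrow> f * a \<in> I"
    "\<And>f g. f \<in> I \<Longrightarrow> g \<in> I \<Longrightarrow> f - g \<in> I"
proof -
  interpret ideal I "mpoly_ring n" by (rule assms)
  show sub: "I \<subseteq> carrier (mpoly_ring n)" by (rule a_subset)
  show "0 \<in> I" using additive_subgroup.zero_closed[OF is_additive_subgroup] by simp
  show add: "f + g \<in> I" if "f \<in> I" "g \<in> I" for f g
    using additive_subgroup.a_closed[OF is_additive_subgroup that] by simp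
  show mult: "a * f \<in> I" if "a \<in> carrier (mpoly_ring n)" "f \<in> I" for a f
    using I_l_closed[OF that(2,1)] by simp
  then show "f * a \<in> I" if "a \<in> carrier (mpoly_ring n)" "f \<in> I" for a f
    using that by (simp add: mult.commute)
  show "f - g \<in> I" if "f \<in> I" "g \<in> I" for f g
    using add[OF that(1) mult[OF carrier_mpoly_uminus[OF carrier_mpoly_1] that(2)]] by simp
qed

lemma ideal_mpoly_sum:
  assumes "ideal I (mpoly_ring n)" "\<And>i. i \<in> A \<Longrightarrow> f i \<in> I"
  shows "(\<Sum>i\<in>A. f i) \<in> (I :: 'a::comm_ring_1 mpoly set)"
  using assms(2) ideal_mpolyD(2,3)[OF assms(1)]
  by (induction A rule: infinite_finite_induct) auto

lemma Idl_ideal: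
  "S \<subseteq> carrier (mpoly_ring n) \<Longrightarrow> ideal (Idl\<^bsub>mpoly_ring n\<^esub> S) (mpoly_ring n :: 'a::comm_ring_1 mpoly ring)"
  by (rule ring.genideal_ideal[OF cring.axioms(1)[OF cring_mpoly_ring]])

lemma Idl_self:
  "S \<subseteq> carrier (mpoly_ring n :: 'a::comm_ring_1 mpoly ring) \<Longrightarrow> S \<subseteq> Idl\<^bsub>mpoly_ring n\<^esub> S"
  by (rule ring.genideal_self[OF cring.axioms(1)[OF cring_mpoly_ring]])

lemma Idl_minimal:
  "ideal I (mpoly_ring n :: 'a::comm_ring_1 mpoly ring) \<Longrightarrow> S \<subseteq> I \<Longrightarrow> Idl\<^bsub>mpoly_ring n\<^esub> S \<subseteq> I"
  by (rule ring.genideal_minimal[OF cring.axioms(1)[OF cring_mpoly_ring]])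

lemma Idl_mono:
  "S \<subseteq> S' \<Longrightarrow> S' \<subseteq> carrier (mpoly_ring n) \<Longrightarrow>
    Idl\<^bsub>mpoly_ring n\<^esub> S \<subseteq> Idl\<^bsub>mpoly_ring n :: 'a::comm_ring_1 mpoly ring\<^esub> S'"
  using Idl_minimal[OF Idl_ideal] Idl_self by blast

lemma ideal_sum_subset_iff:
  fixes I K L :: "'a::comm_ring_1 mpoly set"
  assumes "ideal I (mpoly_ring n)" "ideal K (mpoly_ring n)" "ideal L (mpoly_ring n)"
  shows "I <+>\<^bsub>mpoly_ring n\<^esub> K \<subseteq> L \<longleftrightarrow> I \<subseteq> L \<and> K \<subseteq> L"
  using ideal_mpolyD(2,3)[OF assms(3)] ideal_mpolyD(2)[OF assms(1)] ideal_mpolyD(2)[OF assms(2)]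
  unfolding set_add_def' by (auto simp: subset_iff) (metis add.right_neutral, metis add.left_neutral)

lemma ideal_sum_ideal:
  assumes "ideal I (mpoly_ring n)" "ideal K (mpoly_ring n :: 'a::comm_ring_1 mpoly ring)"
  shows "ideal (I <+>\<^bsub>mpoly_ring n\<^esub> K) (mpoly_ring n)"
  by (rule ring.add_ideals[OF cring.axioms(1)[OF cring_mpoly_ring] assms])

section \<open>Squarefree monomials and the ideal of squares\<close>

definition sqfree :: "nat set \<Rightarrow> monomial" where
  "sqfree S = (\<Sum>i\<in>S. Poly_Mapping.single i 1)"

lemma lookup_sqfree: "finite S \<Longrightarrow> Poly_Mapping.lookup (sqfree S) i = (if i \<in> S then 1 else 0)"
  by (simp add: sqfree_def Poly_Mapping.lookup_sum Poly_Mapping.lookup_single when_def)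

lemma keys_sqfree: "finite S \<Longrightarrow> Poly_Mapping.keys (sqfree S) = S"
  by (auto simp: Poly_Mapping.in_keys_iff lookup_sqfree split: if_splits)

lemma mono_degree_sqfree: "finite S \<Longrightarrow> mono_degree (sqfree S) = card S"
  by (simp add: mono_degree_def keys_sqfree lookup_sqfree)

lemma sqfree_union:
  "finite S \<Longrightarrow> finite T \<Longrightarrow> S \<inter> T = {} \<Longrightarrow> sqfree (S \<union> T) = sqfree S + sqfree T"
  by (simp add: sqfree_def sum.union_disjoint)

lemma sqfree_Diff: "finite T \<Longrightarrow> i \<in> T \<Longrightarrow> sqfree T = sqfree (T - {i}) + Poly_Mapping.single i 1"
  by (simp add: sqfree_def sum.remove add.commute)

lemma sqfree_eqI:
  assumes "\<And>i. Poly_Mapping.lookup t i \<le> 1" shows "t = sqfree (Poly_Mapping.keys t)"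
proof (rule poly_mapping_eqI)
  show "Poly_Mapping.lookup t i = Poly_Mapping.lookup (sqfree (Poly_Mapping.keys t)) i" for i
    using assms[of i] by (auto simp: lookup_sqfree Poly_Mapping.in_keys_iff)
qed

lemma grevlex_less_sqfree:
  assumes "finite S" "finite T" "card S = card T" "revlex_less S T"
  shows "grevlex_less (sqfree S) (sqfree T)"
  using assms unfolding grevlex_less_def revlex_less_def
  by (auto simp: mono_degree_sqfree lookup_sqfree intro!: disjI2)

lemma lookup_times_Var_sqfree:
  fixes f :: "'a::comm_ring_1 mpoly"
  assumes "finite T"
  shows "Poly_Mapping.lookup (f * Var i) (sqfree T) = (if i \<in> T then Poly_Mapping.lookup f (sqfree (T - {i})) else 0)"
proof (cases "i \<in> T")
  case True
  then show ?thesis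
    using lookup_times_single[of f "Poly_Mapping.single i 1" 1 "sqfree (T - {i})"] sqfree_Diff[OF assms True]
    by (simp add: Var_def)
next
  case False
  have "sqfree T \<noteq> v + Poly_Mapping.single i 1" for v
  proof
    assume "sqfree T = v + Poly_Mapping.single i 1"
    then have "Poly_Mapping.lookup (sqfree T) i = Poly_Mapping.lookup v i + 1" by (simp add: Poly_Mapping.lookup_add)
    then show False using False assms by (simp add: lookup_sqfree)
  qed
  from lookup_times_single_eq_0[OF this, of f 1] False show ?thesis by (simp add: Var_def)
qed

text \<open>The bridge between polynomials and families of coefficients.\<close>
lemma lookup_times_sum_power:
  fixes f :: "'a::comm_ring_1 mpoly"
  assumes "T \<subseteq> {1..n}"
  shows "Poly_Mapping.lookup (f * (\<Sum>i=1..n. Var i) ^ r) (sqfree T) =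
    (lower_sum ^^ r) (\<lambda>S. Poly_Mapping.lookup f (sqfree S)) T"
  using assms
proof (induction r arbitrary: T)
  case (Suc r)
  have "finite T" using Suc.prems finite_subset by auto
  have "f * (\<Sum>i=1..n. Var i) ^ Suc r = (\<Sum>i=1..n. f * (\<Sum>i=1..n. Var i) ^ r * Var i)"
    by (simp only: power_Suc2 sum_distrib_left mult.assoc)
  then have "Poly_Mapping.lookup (f * (\<Sum>i=1..n. Var i) ^ Suc r) (sqfree T) =
      (\<Sum>i=1..n. if i \<in> T then Poly_Mapping.lookup (f * (\<Sum>i=1..n. Var i) ^ r) (sqfree (T - {i})) else 0)"
    using \<open>finite T\<close> by (simp only: lookup_sum lookup_times_Var_sqfree)
  also have "\<dots> = (\<Sum>i\<in>T. Poly_Mapping.lookup (f * (\<Sum>i=1..n. Var i) ^ r) (sqfree (T - {i})))"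
    using Suc.prems by (simp add: sum.inter_restrict[symmetric] Int_absorb1)
  also have "\<dots> = (\<Sum>i\<in>T. (lower_sum ^^ r) (\<lambda>S. Poly_Mapping.lookup f (sqfree S)) (T - {i}))"
    using Suc.prems by (intro sum.cong refl Suc.IH) auto
  finally show ?case by (simp only: lower_sum_pow_Suc)
qed simp

lemma single_square_split:
  fixes t :: monomial
  assumes "Poly_Mapping.lookup t i \<ge> 2"
  shows "\<exists>v. t = v + Poly_Mapping.single i 2 \<and> Poly_Mapping.keys v \<subseteq> Poly_Mapping.keys t"
proof (intro exI conjI)
  show t: "t = (t - Poly_Mapping.single i 2) + Poly_Mapping.single i 2"
    using assms by (intro poly_mapping_eqI) (auto simp: Poly_Mapping.lookup_add Poly_Mapping.lookup_minus Poly_Mapping.lookup_single when_def)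
  show "Poly_Mapping.keys (t - Poly_Mapping.single i 2) \<subseteq> Poly_Mapping.keys t"
    by (auto simp: Poly_Mapping.in_keys_iff Poly_Mapping.lookup_minus)
qed

lemma Var_square: "Var i ^ 2 = (Poly_Mapping.single (Poly_Mapping.single i 2) 1 :: 'a::comm_ring_1 mpoly)"
  by (simp add: Var_def power2_eq_square Poly_Mapping.mult_single numeral_2_eq_2 flip: Poly_Mapping.single_add)

text \<open>A monomial ideal is spanned by the monomials it contains; here those that are not squarefree.\<close>
lemma squares_ideal:
  "Idl\<^bsub>mpoly_ring n\<^esub> {Var i ^ 2 | i. i \<in> {1..n}} =
    {f \<in> carrier (mpoly_ring n :: 'a::comm_ring_1 mpoly ring).
      \<forall>t\<in>Poly_Mapping.keys f. \<exists>i. Poly_Mapping.lookup t i \<ge> 2}" (is "?I = ?K")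
proof
  have gens: "{Var i ^ 2 | i. i \<in> {1..n}} \<subseteq> carrier (mpoly_ring n :: 'a mpoly ring)"
    using Var_carrier carrier_mpoly_power by blast
  have "ideal ?K (mpoly_ring n)"
  proof (rule ideal_mpolyI)
    show "f + g \<in> ?K" if "f \<in> ?K" "g \<in> ?K" for f g
      using that Poly_Mapping.keys_add[of f g] carrier_mpoly_add by blast
    show "a * f \<in> ?K" if "a \<in> carrier (mpoly_ring n)" "f \<in> ?K" for a f
    proof -
      have "\<exists>i. Poly_Mapping.lookup t i \<ge> 2" if t: "t \<in> Poly_Mapping.keys (a * f)" for t
      proof -
        obtain u v where uv: "t = u + v" "v \<in> Poly_Mapping.keys f" using Poly_Mapping.keys_mult[of a f] t by blast
        then obtain i where "Poly_Mapping.lookup v i \<ge> 2" using \<open>f \<in> ?K\<close> by blast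
        then show ?thesis using uv by (intro exI[of _ i]) (simp add: Poly_Mapping.lookup_add)
      qed
      then show ?thesis using that carrier_mpoly_mult by blast
    qed
  qed (auto simp: carrier_mpoly_0)
  moreover have "{Var i ^ 2 | i. i \<in> {1..n}} \<subseteq> ?K"
    using gens by (auto simp: Var_square) (metis Poly_Mapping.lookup_single_eq order_refl)
  ultimately show "?I \<subseteq> ?K" by (rule Idl_minimal)
  note I = Idl_ideal[OF gens]
  show "?K \<subseteq> ?I"
  proof
    fix f assume f: "f \<in> ?K"
    have "Poly_Mapping.single t (Poly_Mapping.lookup f t) \<in> ?I" if t: "t \<in> Poly_Mapping.keys f" for t
    proof -
      obtain i where i: "Poly_Mapping.lookup t i \<ge> 2" using f t by auto
      obtain v where v: "t = v + Poly_Mapping.single i 2" "Poly_Mapping.keys v \<subseteq> Poly_Mapping.keys t"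
        using single_square_split[OF i] by blast
      have t_sub: "Poly_Mapping.keys t \<subseteq> {1..n}" using f t by (auto simp: in_carrier_mpoly_ring)
      moreover have "i \<in> Poly_Mapping.keys t" using i by (auto simp: Poly_Mapping.in_keys_iff)
      ultimately have "Var i ^ 2 \<in> ?I" using Idl_self[OF gens] by blast
      then have "Poly_Mapping.single v (Poly_Mapping.lookup f t) * Var i ^ 2 \<in> ?I"
        using v(2) t_sub by (intro ideal_mpolyD(4)[OF I] single_carrier) auto
      then show ?thesis using v(1) by (simp add: Var_square Poly_Mapping.mult_single)
    qed
    then have "(\<Sum>t\<in>Poly_Mapping.keys f. Poly_Mapping.single t (Poly_Mapping.lookup f t)) \<in> ?I"
      by (rule ideal_mpoly_sum[OF I])
    then show "f \<in> ?I" using mpoly_sum_monomials[of f] by simp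
  qed
qed

section \<open>Substitution homomorphisms\<close>

text \<open>Enlarging the index set by terms with coefficient zero lets sums over the terms of different
  polynomials be compared.\<close>
lemma subst_mpoly_eq_sum:
  assumes "finite A" "Poly_Mapping.keys f \<subseteq> A"
  shows "subst_mpoly g f = (\<Sum>m\<in>A. Poly_Mapping.single 0 (Poly_Mapping.lookup f m) *
    (\<Prod>i\<in>Poly_Mapping.keys m. g i ^ Poly_Mapping.lookup m i))"
  unfolding subst_mpoly_def
  by (rule sum.mono_neutral_left) (use assms in \<open>auto simp: Poly_Mapping.in_keys_iff\<close>)

lemma subst_mpoly_add: "subst_mpoly g (f + h) = subst_mpoly g f + subst_mpoly g h"
proof -
  let ?A = "Poly_Mapping.keys f \<union> Poly_Mapping.keys h"
  have "subst_mpoly g u = (\<Sum>m\<in>?A. Poly_Mapping.single 0 (Poly_Mapping.lookup u m) *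
      (\<Prod>i\<in>Poly_Mapping.keys m. g i ^ Poly_Mapping.lookup m i))" if "u \<in> {f, h, f + h}" for u
    using that Poly_Mapping.keys_add[of f h] by (intro subst_mpoly_eq_sum) auto
  then show ?thesis
    by (simp add: Poly_Mapping.lookup_add Poly_Mapping.single_add distrib_right sum.distrib)
qed

lemma subst_mpoly_single:
  "subst_mpoly g (Poly_Mapping.single m c) = Poly_Mapping.single 0 c * (\<Prod>i\<in>Poly_Mapping.keys m. g i ^ Poly_Mapping.lookup m i)"
  by (subst subst_mpoly_eq_sum[of "{m}"]) auto

lemma subst_mpoly_0 [simp]: "subst_mpoly g 0 = 0"
  by (simp add: subst_mpoly_def)

lemma prod_power_lookup_add:
  fixes g :: "nat \<Rightarrow> 'b::comm_monoid_mult"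
  shows "(\<Prod>i\<in>Poly_Mapping.keys (m + m'). g i ^ Poly_Mapping.lookup (m + m') i) =
    (\<Prod>i\<in>Poly_Mapping.keys m. g i ^ Poly_Mapping.lookup m i) * (\<Prod>i\<in>Poly_Mapping.keys m'. g i ^ Poly_Mapping.lookup m' i)"
proof -
  let ?A = "Poly_Mapping.keys m \<union> Poly_Mapping.keys m'"
  have "(\<Prod>i\<in>Poly_Mapping.keys u. g i ^ Poly_Mapping.lookup u i) = (\<Prod>i\<in>?A. g i ^ Poly_Mapping.lookup u i)"
    if "u \<in> {m, m', m + m'}" for u :: monomial
    using that Poly_Mapping.keys_add[of m m']
    by (intro prod.mono_neutral_left) (auto simp: Poly_Mapping.in_keys_iff)
  from this[of m] this[of m'] this[of "m + m'"] show ?thesis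
    by (simp only: Poly_Mapping.lookup_add power_add prod.distrib insertI1 insertI2 simp_thms)
qed

lemma subst_mpoly_mult: "subst_mpoly g (f * h) = subst_mpoly g f * subst_mpoly g h"
proof (induction f rule: mpoly_induct)
  case (add f m c)
  have "subst_mpoly g (Poly_Mapping.single m c * h) = subst_mpoly g (Poly_Mapping.single m c) * subst_mpoly g h"
  proof (induction h rule: mpoly_induct)
    case (add h m' c')
    have "subst_mpoly g (Poly_Mapping.single m c * Poly_Mapping.single m' c') = Poly_Mapping.single 0 (c * c') *
        ((\<Prod>i\<in>Poly_Mapping.keys m. g i ^ Poly_Mapping.lookup m i) * (\<Prod>i\<in>Poly_Mapping.keys m'. g i ^ Poly_Mapping.lookup m' i))"
      by (simp only: Poly_Mapping.mult_single subst_mpoly_single prod_power_lookup_add)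
    also have "Poly_Mapping.single 0 (c * c') = (Poly_Mapping.single 0 c * Poly_Mapping.single 0 c' :: 'a mpoly)"
      by (simp add: Poly_Mapping.mult_single)
    finally have "subst_mpoly g (Poly_Mapping.single m c * Poly_Mapping.single m' c') =
        subst_mpoly g (Poly_Mapping.single m c) * subst_mpoly g (Poly_Mapping.single m' c')"
      by (simp only: subst_mpoly_single mult_ac)
    then show ?case using add by (simp add: distrib_left subst_mpoly_add)
  qed simp
  then show ?case using add by (simp add: distrib_right subst_mpoly_add)
qed simp

lemma subst_mpoly_1 [simp]: "subst_mpoly g 1 = 1"
  using subst_mpoly_single[of g 0 1] by simp

lemma subst_mpoly_Var [simp]: "subst_mpoly g (Var i) = g i"
  by (simp add: Var_def subst_mpoly_single)

lemma subst_mpoly_diff: "subst_mpoly g (f - h) = subst_mpoly g f - subst_mpoly g h"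
  using subst_mpoly_add[of g "f - h" h] by (simp add: algebra_simps)

lemma subst_mpoly_prod: "subst_mpoly g (\<Prod>i\<in>A. f i) = (\<Prod>i\<in>A. subst_mpoly g (f i))"
  by (induction A rule: infinite_finite_induct) (simp_all add: subst_mpoly_mult)

section \<open>Leading monomials in the colon ideal\<close>

abbreviation (input) squares :: "nat \<Rightarrow> 'a::comm_ring_1 mpoly set" where
  "squares n \<equiv> Idl\<^bsub>mpoly_ring n\<^esub> {Var i ^ 2 | i. i \<in> {1..n}}"

lemma squares_is_ideal: "ideal (squares n) (mpoly_ring n :: 'a::comm_ring_1 mpoly ring)"
  using Var_carrier carrier_mpoly_power by (intro Idl_ideal) blast

lemma Var_square_in_squares:
  assumes "i \<in> {1..n}" shows "(Var i ^ 2 :: 'a::comm_ring_1 mpoly) \<in> squares n"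
proof -
  have "{Var i ^ 2 | i. i \<in> {1..n}} \<subseteq> carrier (mpoly_ring n :: 'a mpoly ring)"
    using Var_carrier carrier_mpoly_power by blast
  from Idl_self[OF this] assms show ?thesis by blast
qed

lemma lookup_sqfree_squares:
  assumes "f \<in> squares n" "finite S" shows "Poly_Mapping.lookup f (sqfree S) = 0"
proof (rule ccontr)
  assume "Poly_Mapping.lookup f (sqfree S) \<noteq> 0"
  then have "sqfree S \<in> Poly_Mapping.keys f" by (simp add: Poly_Mapping.in_keys_iff)
  then obtain i where "Poly_Mapping.lookup (sqfree S) i \<ge> 2"
    using assms(1) unfolding squares_ideal by blast
  then show False using assms(2) by (simp add: lookup_sqfree split: if_splits)
qed

text \<open>With the preceding lemma: the classes modulo the squares are determined by the squarefree
  coefficients.\<close>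
lemma in_squares_if_lookup_sqfree:
  assumes "f \<in> carrier (mpoly_ring n)" "\<And>S. S \<subseteq> {1..n} \<Longrightarrow> Poly_Mapping.lookup f (sqfree S) = 0"
  shows "f \<in> squares n"
  unfolding squares_ideal
proof (intro CollectI conjI ballI assms(1))
  fix t assume t: "t \<in> Poly_Mapping.keys f"
  show "\<exists>i. 2 \<le> Poly_Mapping.lookup t i"
  proof (rule ccontr)
    assume "\<nexists>i. 2 \<le> Poly_Mapping.lookup t i"
    then have "Poly_Mapping.lookup t i \<le> 1" for i by (metis not_less_eq_eq numeral_2_eq_2 One_nat_def)
    then have "t = sqfree (Poly_Mapping.keys t)" by (rule sqfree_eqI)
    moreover have "Poly_Mapping.keys t \<subseteq> {1..n}" using t assms(1) by (auto simp: in_carrier_mpoly_ring)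
    ultimately show False using t assms(2) by (metis Poly_Mapping.in_keys_iff)
  qed
qed

lemma colon_ballot:
  fixes f :: "'a::field mpoly"
  assumes char: "\<And>m. 0 < m \<Longrightarrow> m \<le> n \<Longrightarrow> (of_nat m :: 'a) \<noteq> 0"
    and colon: "f * (\<Sum>i=1..n. Var i) ^ r \<in> squares n"
    and S: "S \<subseteq> {1..n}" "Poly_Mapping.lookup f (sqfree S) \<noteq> 0"
    and lead: "\<And>S'. S' \<subseteq> {1..n} \<Longrightarrow> card S' = card S \<Longrightarrow> revlex_less S S' \<Longrightarrow>
      Poly_Mapping.lookup f (sqfree S') = 0"
    and "x \<le> n"
  shows "x < 2 * card (S \<inter> {1..x}) + r"
proof (rule revlex_leading_ballot[OF char _ S(1) refl _ lead \<open>x \<le> n\<close>])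
  fix T assume T: "T \<subseteq> {1..n}"
  then have "finite T" using finite_subset by auto
  then show "(lower_sum ^^ r) (\<lambda>S. Poly_Mapping.lookup f (sqfree S)) T = 0"
    using lookup_times_sum_power[OF T, of f r] lookup_sqfree_squares[OF colon] by simp
qed (use S in auto)

text \<open>The index sequences \<open>i\<^sub>1 < \<dots> < i\<^sub>m\<close> of the squarefree generators of the initial ideal.\<close>
definition ballot_seq :: "nat \<Rightarrow> (nat \<Rightarrow> nat) \<Rightarrow> bool" where
  "ballot_seq m i \<longleftrightarrow> 0 < i 1 \<and> strict_mono_on {1..m} i \<and> (\<forall>j\<in>{1..m}. i j \<le> 2 * j)"

text \<open>A path that stays above height \<open>-2\<close> has at least \<open>j\<close> up-steps among its first \<open>2 * j\<close> steps, which
  says that its \<open>j\<close>-th up-step comes at position \<open>2 * j\<close> or earlier.\<close>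
lemma ballot_seq_of_set:
  assumes S: "S \<subseteq> {1..n}" and ballot: "\<And>x. x \<le> n \<Longrightarrow> x < 2 * card (S \<inter> {1..x}) + 2"
    and n: "n \<ge> 2"
  shows "\<exists>i. ballot_seq (n div 2) i \<and> i ` {1..n div 2} \<subseteq> S"
proof -
  have fin: "finite S" using S finite_subset by auto
  then obtain h where h: "bij_betw h {..<card S} S" "strict_mono_on {..<card S} h"
    using ex_bij_betw_strict_mono_card by blast
  have card: "j \<le> card (S \<inter> {1..2 * j})" if "j \<le> n div 2" for j
    using ballot[of "2 * j"] that by linarith
  have "card (S \<inter> {1..2 * (n div 2)}) \<le> card S" using fin by (intro card_mono) auto
  then have m: "n div 2 \<le> card S" using card[of "n div 2"] by simp
  have mem: "h k \<in> S" if "k < card S" for k using h(1) that by (auto simp: bij_betw_def)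
  have bound: "h (j - 1) \<le> 2 * j" if j: "j \<in> {1..n div 2}" for j
  proof (rule ccontr)
    assume gt: "\<not> h (j - 1) \<le> 2 * j"
    have "S \<inter> {1..2 * j} \<subseteq> h ` {..<j - 1}"
    proof
      fix x assume x: "x \<in> S \<inter> {1..2 * j}"
      then obtain k where k: "k < card S" "x = h k" using h(1) by (auto simp: bij_betw_def)
      have "k < j - 1"
      proof (rule ccontr)
        assume "\<not> k < j - 1"
        then have "h (j - 1) \<le> h k"
          using strict_mono_onD[OF h(2), of "j - 1" k] k j m by (cases "k = j - 1") auto
        then show False using gt x k by simp
      qed
      then show "x \<in> h ` {..<j - 1}" using k by auto
    qed
    then have "card (S \<inter> {1..2 * j}) \<le> card (h ` {..<j - 1})" by (intro card_mono) auto
    also have "\<dots> \<le> j - 1" using card_image_le[of "{..<j - 1}" h] by simp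
    finally have "card (S \<inter> {1..2 * j}) \<le> j - 1" .
    moreover have "1 \<le> j" "j \<le> card (S \<inter> {1..2 * j})" using card[of j] j by auto
    ultimately show False by linarith
  qed
  show ?thesis
  proof (intro exI conjI)
    show "ballot_seq (n div 2) (\<lambda>j. h (j - 1))"
      unfolding ballot_seq_def
    proof (intro conjI ballI strict_mono_onI)
      have "0 < card S" using m n by linarith
      then show "0 < h (1 - 1)" using mem[of 0] S by fastforce
      show "h (j - 1) < h (k - 1)" if "j \<in> {1..n div 2}" "k \<in> {1..n div 2}" "j < k" for j k
        using that m by (intro strict_mono_onD[OF h(2)]) auto
    qed (use bound in auto)
    show "(\<lambda>j. h (j - 1)) ` {1..n div 2} \<subseteq> S" using mem m by auto
  qed
qed

text \<open>Either the leading monomial lies in the ideal of squares, or it is squarefree and then the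
  leading one among the squarefree monomials, so that \<open>colon_ballot\<close> applies. An inhomogeneous
  polynomial causes no trouble: the order compares degrees first, and only sets of equal size compete.\<close>
lemma colon_lead:
  fixes f :: "'a::field mpoly"
  assumes char: "\<And>m. 0 < m \<Longrightarrow> m \<le> n \<Longrightarrow> (of_nat m :: 'a) \<noteq> 0"
    and n: "n \<ge> 2"
    and f: "f \<in> carrier (mpoly_ring n)" "f \<noteq> 0" "f * (\<Sum>i=1..n. Var i) ^ 2 \<in> squares n"
  shows "(\<exists>i. Poly_Mapping.lookup (lead_monomial f) i \<ge> 2) \<or>
    (\<exists>i v. ballot_seq (n div 2) i \<and> Poly_Mapping.keys v \<subseteq> {1..n} \<and>
      lead_monomial f = v + sqfree (i ` {1..n div 2}))"
proof (cases "\<exists>i. Poly_Mapping.lookup (lead_monomial f) i \<ge> 2")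
  case False
  let ?S = "Poly_Mapping.keys (lead_monomial f)"
  have "Poly_Mapping.lookup (lead_monomial f) i \<le> 1" for i
    using False by (metis not_less_eq_eq numeral_2_eq_2 One_nat_def)
  then have eq: "lead_monomial f = sqfree ?S" by (rule sqfree_eqI)
  have mem: "lead_monomial f \<in> Poly_Mapping.keys f" by (rule lead_monomial_props(1)[OF f(2)])
  then have S: "?S \<subseteq> {1..n}" using f(1) by (auto simp: in_carrier_mpoly_ring)
  have lead: "Poly_Mapping.lookup f (sqfree S') = 0"
    if "S' \<subseteq> {1..n}" "card S' = card ?S" "revlex_less ?S S'" for S'
  proof (rule ccontr)
    assume "Poly_Mapping.lookup f (sqfree S') \<noteq> 0"
    then have "sqfree S' \<in> Poly_Mapping.keys f" by (simp add: Poly_Mapping.in_keys_iff)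
    moreover have "grevlex_less (lead_monomial f) (sqfree S')"
      using that finite_subset[OF that(1)] eq grevlex_less_sqfree[of ?S S'] by simp
    ultimately show False
      using lead_monomial_props(2)[OF f(2)] grevlex_less_trans grevlex_less_irrefl by metis
  qed
  have "Poly_Mapping.lookup f (sqfree ?S) \<noteq> 0" using mem eq by (simp add: Poly_Mapping.in_keys_iff)
  from colon_ballot[OF char f(3) S this lead]
  obtain i where i: "ballot_seq (n div 2) i" "i ` {1..n div 2} \<subseteq> ?S"
    using ballot_seq_of_set[OF S _ n] by blast
  let ?T = "?S - i ` {1..n div 2}"
  have "sqfree ?S = sqfree ?T + sqfree (i ` {1..n div 2})"
    using i(2) sqfree_union[of ?T "i ` {1..n div 2}"] by (simp add: Un_absorb2 Int_commute)
  moreover have "Poly_Mapping.keys (sqfree ?T) \<subseteq> {1..n}" using S by (auto simp: keys_sqfree)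
  ultimately show ?thesis using i(1) eq by metis
qed simp

text \<open>Homogeneity in a given degree, with zero a form of every degree; \<open>mpoly_degree\<close> has no
  meaningful value at zero.\<close>
definition is_form :: "nat \<Rightarrow> 'a::zero mpoly \<Rightarrow> bool" where
  "is_form d f \<longleftrightarrow> (\<forall>t\<in>Poly_Mapping.keys f. mono_degree t = d)"

text \<open>A squarefree monomial of degree less than \<open>n div 2\<close> is too short for its path to stay above
  height \<open>-2\<close>.\<close>
lemma colon_low_degree:
  fixes f :: "'a::field mpoly"
  assumes char: "\<And>m. 0 < m \<Longrightarrow> m \<le> n \<Longrightarrow> (of_nat m :: 'a) \<noteq> 0"
    and f: "f \<in> carrier (mpoly_ring n)" "f * (\<Sum>i=1..n. Var i) ^ 2 \<in> squares n"
    and d: "is_form d f" "d < n div 2"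
  shows "f \<in> squares n"
proof (rule in_squares_if_lookup_sqfree[OF f(1)], rule ccontr)
  fix U assume U: "U \<subseteq> {1..n}" "Poly_Mapping.lookup f (sqfree U) \<noteq> 0"
  let ?A = "{S. S \<subseteq> {1..n} \<and> Poly_Mapping.lookup f (sqfree S) \<noteq> 0}"
  have fin: "finite S" if "S \<in> ?A" for S using that finite_subset by auto
  have card: "card S = d" if "S \<in> ?A" for S
    using that d(1) mono_degree_sqfree[OF fin[OF that]] by (auto simp: is_form_def Poly_Mapping.in_keys_iff)
  have "\<exists>S\<in>?A. \<forall>S'\<in>?A. \<not> revlex_less S S'"
    by (rule exists_revlex_leading) (use U fin in auto)
  then obtain S where S: "S \<in> ?A" "\<forall>S'\<in>?A. \<not> revlex_less S S'" by blast
  have "2 * d + 2 < 2 * card (S \<inter> {1..2 * d + 2}) + 2"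
    by (rule colon_ballot[OF char f(2)]) (use S d in auto)
  moreover have "card (S \<inter> {1..2 * d + 2}) \<le> d"
    using card[OF S(1)] fin[OF S(1)] card_mono[of S "S \<inter> {1..2 * d + 2}"] by simp
  ultimately show False by simp
qed

section \<open>Products of differences of variables\<close>

text \<open>The permuted generators for both parities of \<open>n\<close> at once: when \<open>n\<close> is even, the last factor,
  with \<open>2 * j = n\<close>, is a single variable. For the identity and \<open>n = 2 * p + 1\<close> this is the Specht
  polynomial of shape \<open>(p + 1, p)\<close>.\<close>
definition spec_poly :: "nat \<Rightarrow> (nat \<Rightarrow> nat) \<Rightarrow> 'a::comm_ring_1 mpoly" where
  "spec_poly n \<sigma> =
    (\<Prod>j=1..n div 2. Var (\<sigma> (2 * j - 1)) - (if 2 * j < n then Var (\<sigma> (2 * j)) else 0))"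

lemma spec_poly_odd:
  assumes "odd n"
  shows "spec_poly n id = (\<Prod>j=1..(n - 1) div 2. (Var (2 * j - 1) - Var (2 * j)))"
proof -
  have "n div 2 = (n - 1) div 2" using assms by (auto elim: oddE)
  then show ?thesis unfolding spec_poly_def using assms by (intro prod.cong) (auto elim!: oddE)
qed

lemma spec_poly_even:
  assumes "even n" "n \<ge> 2"
  shows "spec_poly n id = (\<Prod>j=1..(n - 2) div 2. (Var (2 * j - 1) - Var (2 * j))) * Var (n - 1)"
proof -
  have m: "n div 2 = Suc ((n - 2) div 2)" "2 * Suc ((n - 2) div 2) = n" using assms by auto
  have "(\<Prod>j=1..(n - 2) div 2. Var (2 * j - 1) - (if 2 * j < n then Var (2 * j) else 0)) =
    (\<Prod>j=1..(n - 2) div 2. (Var (2 * j - 1) - Var (2 * j) :: 'a mpoly))"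
    using m by (intro prod.cong) auto
  then show ?thesis unfolding spec_poly_def m(1) using m(2)
    by (simp add: prod.atLeastLessThan_Suc)
qed

lemma perm_act_spec_poly: "perm_act \<sigma> (spec_poly n id) = spec_poly n \<sigma>"
  unfolding perm_act_def spec_poly_def subst_mpoly_prod
  by (intro prod.cong refl) (simp add: subst_mpoly_diff)

lemma permutes_interval: "\<sigma> permutes {1..n} \<Longrightarrow> i \<in> {1..n} \<Longrightarrow> \<sigma> i \<in> {1..n}"
  by (simp only: permutes_in_image)

lemma spec_poly_carrier:
  assumes "\<sigma> permutes {1..n}" shows "spec_poly n \<sigma> \<in> carrier (mpoly_ring n)"
  unfolding spec_poly_def
  by (intro carrier_mpoly_prod carrier_mpoly_diff)
    (auto intro!: Var_carrier carrier_mpoly_0 permutes_interval[OF assms])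

lemma is_form_mult: "is_form d f \<Longrightarrow> is_form e g \<Longrightarrow> is_form (d + e) (f * g :: 'a::comm_ring_1 mpoly)"
  using Poly_Mapping.keys_mult[of f g] unfolding is_form_def by (force simp: mono_degree_add)

lemma is_form_prod:
  assumes "\<And>i. i \<in> A \<Longrightarrow> is_form 1 (f i :: 'a::comm_ring_1 mpoly)" "finite A"
  shows "is_form (card A) (\<Prod>i\<in>A. f i)"
  using assms(2,1)
proof (induction A)
  case empty
  then show ?case by (simp add: is_form_def mono_degree_def)
next
  case (insert x A)
  then show ?case using is_form_mult[of 1 "f x" "card A"] by simp
qed

lemma is_form_Var: "is_form 1 (Var i :: 'a::comm_ring_1 mpoly)"
  by (simp add: is_form_def keys_Var)

lemma is_form_diff: "is_form d f \<Longrightarrow> is_form d g \<Longrightarrow> is_form d (f - g :: 'a::comm_ring_1 mpoly)"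
  using keys_diff[of f g] by (auto simp: is_form_def)

lemma is_form_0 [simp]: "is_form d 0"
  by (simp add: is_form_def)

lemma spec_poly_form: "is_form (n div 2) (spec_poly n \<sigma> :: 'a::comm_ring_1 mpoly)"
proof -
  have "is_form (card {1..n div 2}) (spec_poly n \<sigma> :: 'a::comm_ring_1 mpoly)"
    unfolding spec_poly_def by (intro is_form_prod is_form_diff) (auto simp del: One_nat_def intro: is_form_Var)
  then show ?thesis by simp
qed

lemma sum_pairs:
  fixes g :: "nat \<Rightarrow> 'b::comm_monoid_add"
  shows "(\<Sum>i=1..2 * m. g i) = (\<Sum>j=1..m. g (2 * j - 1) + g (2 * j))"
  by (induction m) (simp_all add: add.assoc)

text \<open>A factor \<open>x - y\<close> kills \<open>x + y\<close> modulo squares. Hence multiplying by \<open>s\<close> is the same as multiplying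
  by the sum \<open>r\<close> of the variables not in a full pair: one variable if \<open>n\<close> is odd, whose square is zero,
  and two if \<open>n\<close> is even, one of which is itself a factor of the product.\<close>
lemma spec_poly_colon:
  assumes \<sigma>: "\<sigma> permutes {1..n}" and n: "n \<ge> 2"
  shows "spec_poly n \<sigma> * (\<Sum>i=1..n. Var i) ^ 2 \<in> (squares n :: 'a::comm_ring_1 mpoly set)"
proof -
  let ?P = "spec_poly n \<sigma> :: 'a mpoly"
  let ?s = "(\<Sum>i=1..n. Var i) :: 'a mpoly"
  let ?x = "\<lambda>i. Var (\<sigma> i) :: 'a mpoly"
  let ?pair = "\<lambda>j. ?x (2 * j - 1) + ?x (2 * j)"
  define r where "r = (if odd n then ?x n else ?x (n - 1) + ?x n)"
  note J = squares_is_ideal[of n, where 'a = 'a]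
  have V: "?x i \<in> carrier (mpoly_ring n)" if "i \<in> {1..n}" for i
    using permutes_interval[OF \<sigma> that] by (rule Var_carrier)
  have sq: "?x i ^ 2 \<in> squares n" if "i \<in> {1..n}" for i
    using permutes_interval[OF \<sigma> that] by (rule Var_square_in_squares)
  have P: "?P \<in> carrier (mpoly_ring n)" by (rule spec_poly_carrier[OF \<sigma>])
  have r: "r \<in> carrier (mpoly_ring n)" unfolding r_def using n by (auto intro!: V carrier_mpoly_add)
  have s: "?s \<in> carrier (mpoly_ring n)" by (intro carrier_mpoly_sum Var_carrier)
  have factor: "\<exists>q\<in>carrier (mpoly_ring n).
      ?P = (?x (2 * j - 1) - (if 2 * j < n then ?x (2 * j) else 0)) * q" if "j \<in> {1..n div 2}" for j
  proof
    let ?f = "\<lambda>j. ?x (2 * j - 1) - (if 2 * j < n then ?x (2 * j) else 0)"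
    show "?P = ?f j * prod ?f ({1..n div 2} - {j})"
      unfolding spec_poly_def by (rule prod.remove) (use that in auto)
    show "prod ?f ({1..n div 2} - {j}) \<in> carrier (mpoly_ring n)"
      by (intro carrier_mpoly_prod carrier_mpoly_diff) (auto intro!: V carrier_mpoly_0)
  qed
  have pair: "?P * ?pair j \<in> squares n" if j: "j \<in> {1..n div 2}" "2 * j < n" for j
  proof -
    obtain q where q: "q \<in> carrier (mpoly_ring n)" "?P = (?x (2 * j - 1) - ?x (2 * j)) * q"
      using factor[OF j(1)] j(2) by auto
    have "?P * ?pair j = q * (?x (2 * j - 1) ^ 2 - ?x (2 * j) ^ 2)"
      unfolding q(2) by (simp add: power2_eq_square algebra_simps)
    also have "\<dots> \<in> squares n"
      using j by (intro ideal_mpolyD(4,6)[OF J] q(1) sq) auto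
    finally show ?thesis .
  qed
  have s_eq: "?s = (\<Sum>i=1..n. ?x i)" using sum.permute[OF \<sigma>, of Var] by (simp add: o_def)
  have "?s = (\<Sum>j | j \<in> {1..n div 2} \<and> 2 * j < n. ?pair j) + r"
  proof (cases "odd n")
    case True
    then have n2: "n = Suc (2 * (n div 2))" by auto
    have "?s = (\<Sum>i=1..2 * (n div 2). ?x i) + ?x n"
      unfolding s_eq by (subst n2, subst sum.cl_ivl_Suc) (use n2 in auto)
    moreover have "{j. j \<in> {1..n div 2} \<and> 2 * j < n} = {1..n div 2}" using n2 by auto
    ultimately show ?thesis using True unfolding sum_pairs r_def by simp
  next
    case False
    define m where "m = n div 2 - 1"
    have n2: "n = 2 * Suc m" "n div 2 = Suc m" using False n by (auto simp: m_def)
    have "?s = (\<Sum>i=1..2 * Suc m. ?x i)" by (simp only: s_eq flip: n2(1))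
    also have "\<dots> = (\<Sum>j=1..Suc m. ?pair j)" by (rule sum_pairs)
    also have "\<dots> = (\<Sum>j=1..m. ?pair j) + (?x (n - 1) + ?x n)"
      using n2 by (simp add: sum.cl_ivl_Suc)
    moreover have "{j. j \<in> {1..n div 2} \<and> 2 * j < n} = {1..m}" using n2 by auto
    ultimately show ?thesis using False unfolding r_def by simp
  qed
  then have "?P * ?s - ?P * r = (\<Sum>j | j \<in> {1..n div 2} \<and> 2 * j < n. ?P * ?pair j)"
    by (simp add: distrib_left sum_distrib_left)
  also have "\<dots> \<in> squares n" by (rule ideal_mpoly_sum[OF J]) (use pair in auto)
  finally have diff: "?P * ?s - ?P * r \<in> squares n" .
  have "?P * r ^ 2 \<in> squares n"
  proof (cases "odd n")
    case True
    have "?P * ?x n ^ 2 \<in> squares n" using n by (intro ideal_mpolyD(4)[OF J] P sq) simp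
    then show ?thesis using True unfolding r_def by simp
  next
    case False
    then have j: "n div 2 \<in> {1..n div 2}" "2 * (n div 2) = n" using n by auto
    obtain q where q: "q \<in> carrier (mpoly_ring n)" "?P = ?x (n - 1) * q"
      using factor[OF j(1)] j(2) by auto
    \<comment> \<open>The mixed term \<open>2 x y P\<close> contains \<open>x\<^sup>2\<close> because \<open>P = x q\<close>.\<close>
    have "?P * r ^ 2 = (?P + (q * ?x n + q * ?x n)) * ?x (n - 1) ^ 2 + ?P * ?x n ^ 2"
      using False unfolding r_def q(2) by (simp add: power2_eq_square algebra_simps)
    also have "\<dots> \<in> squares n"
      using n by (intro ideal_mpolyD(3,4)[OF J] sq carrier_mpoly_add carrier_mpoly_mult P q(1) V) auto
    finally show ?thesis .
  qed
  then have "(?s + r) * (?P * ?s - ?P * r) + ?P * r ^ 2 \<in> squares n"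
    by (rule ideal_mpolyD(3)[OF J ideal_mpolyD(4)[OF J carrier_mpoly_add[OF s r] diff]])
  also have "(?s + r) * (?P * ?s - ?P * r) + ?P * r ^ 2 = ?P * ?s ^ 2"
    by (simp add: power2_eq_square algebra_simps)
  finally show ?thesis .
qed

lemma monic_at_Var_diff:
  assumes "c \<Longrightarrow> a < b"
  shows "monic_at (Poly_Mapping.single a 1) (Var a - (if c then Var b else 0) :: 'a::comm_ring_1 mpoly)"
proof -
  let ?f = "Var a - (if c then Var b else 0) :: 'a mpoly"
  have "u = Poly_Mapping.single a 1 \<or> c \<and> u = Poly_Mapping.single b 1" if "u \<in> Poly_Mapping.keys ?f" for u
    using that keys_diff[of "Var a" "if c then Var b else 0 :: 'a mpoly"]
    by (auto simp: keys_Var split: if_splits)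
  moreover have less: "grevlex_less (Poly_Mapping.single b 1) (Poly_Mapping.single a 1)" if c
    using assms[OF that] unfolding grevlex_less_def
    by (auto intro!: exI[of _ b] simp: Poly_Mapping.lookup_single when_def)
  moreover have "Poly_Mapping.lookup ?f (Poly_Mapping.single a 1) = 1"
    using less grevlex_less_irrefl[of "Poly_Mapping.single a 1"]
    by (auto simp: Var_def Poly_Mapping.lookup_minus Poly_Mapping.lookup_single when_def)
  ultimately show ?thesis unfolding monic_at_def by blast
qed

lemma ballot_seq_mono:
  assumes "ballot_seq m i" "1 \<le> j" "j \<le> k" "k \<le> m" shows "i j \<le> i k" "0 < i j"
proof -
  have mono: "i j \<le> i k" if "1 \<le> j" "j \<le> k" "k \<le> m" for j k
    using assms(1) that unfolding ballot_seq_def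
    by (cases "j = k") (auto dest!: strict_mono_onD[of _ _ j k])
  show "i j \<le> i k" using assms mono by simp
  show "0 < i j" using mono[of 1 j] assms unfolding ballot_seq_def by simp
qed

lemma ballot_seq_inj: "ballot_seq m i \<Longrightarrow> inj_on i {1..m}"
  unfolding ballot_seq_def using strict_mono_on_imp_inj_on by blast

lemma ballot_seq_image:
  assumes "ballot_seq (n div 2) i" shows "i ` {1..n div 2} \<subseteq> {1..n}"
proof (rule image_subsetI)
  fix j assume j: "j \<in> {1..n div 2}"
  then have "i j \<le> 2 * j" using assms by (simp add: ballot_seq_def)
  moreover have "0 < i j" using ballot_seq_mono(2)[OF assms, of j j] j by simp
  ultimately show "i j \<in> {1..n}" using j by auto
qed

text \<open>If \<open>h j\<close>, the element of the complement with exactly \<open>j\<close> predecessors there, were below \<open>i j\<close>, then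
  \<open>{1..i j}\<close> would contain the \<open>j + 1\<close> values \<open>h 0, \<dots>, h j\<close> and the \<open>j\<close> values \<open>i 1, \<dots>, i j\<close>,
  contradicting \<open>i j \<le> 2 * j\<close>.\<close>
lemma complement_enumeration_gt:
  assumes i: "ballot_seq m i" and h: "strict_mono_on {..<p} h"
    and disj: "h ` {..<p} \<inter> i ` {1..m} = {}" and pos: "\<And>k. k < p \<Longrightarrow> 0 < h k"
    and j: "1 \<le> j" "j \<le> m" "j < p"
  shows "i j < h j"
proof (rule ccontr)
  assume "\<not> i j < h j"
  then have le: "h j \<le> i j" by simp
  have "h ` {..j} \<union> i ` {1..j} \<subseteq> {1..i j}"
  proof
    fix x assume "x \<in> h ` {..j} \<union> i ` {1..j}"
    then consider k where "k \<le> j" "x = h k" | k where "1 \<le> k" "k \<le> j" "x = i k" by auto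
    then show "x \<in> {1..i j}"
    proof cases
      case 1
      then have "h k \<le> h j" using strict_mono_onD[OF h, of k j] j by (cases "k = j") auto
      then show ?thesis using 1 le pos[of k] j by auto
    next
      case 2
      then show ?thesis using ballot_seq_mono[OF i, of k j] j by auto
    qed
  qed
  from card_mono[OF finite_atLeastAtMost this]
  have "card (h ` {..j} \<union> i ` {1..j}) \<le> i j" by simp
  moreover have "h ` {..j} \<subseteq> h ` {..<p}" "i ` {1..j} \<subseteq> i ` {1..m}" using j by auto
  then have "h ` {..j} \<inter> i ` {1..j} = {}" using disj by blast
  moreover have "inj_on h {..j}"
    using j strict_mono_on_imp_inj_on[OF h] by (rule_tac inj_on_subset) auto
  moreover have "inj_on i {1..j}"
    using j ballot_seq_inj[OF i] by (rule_tac inj_on_subset) auto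
  ultimately have "Suc j + j \<le> i j" by (simp add: card_Un_disjoint card_image)
  moreover have "i j \<le> 2 * j" using i j unfolding ballot_seq_def by auto
  ultimately show False by linarith
qed

text \<open>The permutation pairs \<open>i j\<close> with the larger \<open>h j\<close>, so that each factor has leading monomial
  \<open>x\<^sub>i\<^sub>(\<^sub>j\<^sub>)\<close>. The least element \<open>h 0\<close> of the complement is left over and becomes the image of \<open>n\<close>, the
  index that does not occur in the product.\<close>
lemma spec_poly_lead:
  assumes i: "ballot_seq (n div 2) i" and n: "n \<ge> 2"
  shows "\<exists>\<sigma>. \<sigma> permutes {1..n} \<and>
    monic_at (sqfree (i ` {1..n div 2})) (spec_poly n \<sigma> :: 'a::comm_ring_1 mpoly)"
proof -
  define m where "m = n div 2"
  have i: "ballot_seq m i" using i by (simp add: m_def)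
  define C where "C = {1..n} - i ` {1..m}"
  have i_sub: "i ` {1..m} \<subseteq> {1..n}" using ballot_seq_image assms(1) by (simp add: m_def)
  have "finite C" by (simp add: C_def)
  have cardC: "card C = n - m"
    unfolding C_def using i_sub ballot_seq_inj[OF i]
    by (subst card_Diff_subset) (auto simp: card_image)
  obtain h where h: "bij_betw h {..<n - m} C" "strict_mono_on {..<n - m} h"
    using ex_bij_betw_strict_mono_card[OF \<open>finite C\<close>] unfolding cardC by blast
  have h_img: "h ` {..<n - m} = C" and h_inj: "inj_on h {..<n - m}"
    using h(1) by (auto simp: bij_betw_def)
  \<comment> \<open>\<open>2 j - 1 \<mapsto> i j\<close> and \<open>2 j \<mapsto> h j\<close>, except that \<open>n\<close> itself, of either parity, goes to \<open>h 0\<close>.\<close>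
  define \<sigma> where "\<sigma> x = (if x \<in> {1..n} then
      (if x = n then h 0 else if odd x then i ((x + 1) div 2) else h (x div 2)) else x)" for x
  have odd_case: "(x + 1) div 2 \<in> {1..m}" if "x \<in> {1..n}" "x \<noteq> n" "odd x" for x
    using that unfolding m_def by auto presburger
  have even_case: "x div 2 < n - m" "x div 2 \<noteq> 0" if "x \<in> {1..n}" "x \<noteq> n" "even x" for x
    using that unfolding m_def by auto
  have "0 < n - m" using n by (simp add: m_def)
  have \<sigma>_cases: "(if x = n \<or> even x then \<sigma> x \<in> C else \<sigma> x \<in> i ` {1..m})" if "x \<in> {1..n}" for x
    using that odd_case[OF that] even_case[OF that] \<open>0 < n - m\<close> h_img by (auto simp: \<sigma>_def)
  have inj: "inj_on \<sigma> {1..n}"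
  proof (rule inj_onI)
    fix x y assume x: "x \<in> {1..n}" and y: "y \<in> {1..n}" and eq: "\<sigma> x = \<sigma> y"
    have same: "(x = n \<or> even x) = (y = n \<or> even y)"
      using \<sigma>_cases[OF x] \<sigma>_cases[OF y] eq unfolding C_def by (auto split: if_splits)
    show "x = y"
    proof (cases "x = n \<or> even x")
      case True
      let ?k = "\<lambda>x. if x = n then 0 else x div 2"
      have "\<sigma> z = h (?k z)" "?k z < n - m" if "z \<in> {1..n}" "z = n \<or> even z" for z
        using that even_case[of z] \<open>0 < n - m\<close> by (auto simp: \<sigma>_def)
      then have "?k x = ?k y" using True same x y eq inj_onD[OF h_inj, of "?k x" "?k y"] by auto
      then show ?thesis using True same x y even_case(2)[of x] even_case(2)[of y]
        by (auto split: if_splits elim!: evenE)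
    next
      case False
      then have "i ((x + 1) div 2) = i ((y + 1) div 2)" using same eq x y by (simp add: \<sigma>_def)
      then have "(x + 1) div 2 = (y + 1) div 2"
        using inj_onD[OF ballot_seq_inj[OF i]] odd_case[of x] odd_case[of y] False same x y by blast
      then show ?thesis using False same by (auto elim!: oddE)
    qed
  qed
  have "\<sigma> ` {1..n} \<subseteq> {1..n}"
    using \<sigma>_cases i_sub unfolding C_def by (fastforce split: if_splits)
  then have "bij_betw \<sigma> {1..n} {1..n}"
    using inj endo_inj_surj[of "{1..n}" \<sigma>] by (auto simp: bij_betw_def)
  then have perm: "\<sigma> permutes {1..n}" by (rule bij_imp_permutes) (auto simp: \<sigma>_def)
  have factor: "monic_at (Poly_Mapping.single (i j) 1)
      (Var (\<sigma> (2 * j - 1)) - (if 2 * j < n then Var (\<sigma> (2 * j)) else 0) :: 'a mpoly)"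
    if j: "j \<in> {1..n div 2}" for j
  proof -
    obtain k where k: "j = Suc k" "Suc k \<le> n div 2" using j by (cases j) auto
    have "2 * j - 1 \<in> {1..n}" "2 * j - 1 \<noteq> n" "odd (2 * j - 1)" "(2 * j - 1 + 1) div 2 = j"
      using k by auto
    then have "\<sigma> (2 * j - 1) = i j" unfolding \<sigma>_def by simp
    moreover have "\<sigma> (2 * j) = h j \<and> i j < h j" if "2 * j < n"
    proof
      show "\<sigma> (2 * j) = h j" using that j by (simp add: \<sigma>_def)
      show "i j < h j"
      proof (rule complement_enumeration_gt[OF i h(2)])
        show "h ` {..<n - m} \<inter> i ` {1..m} = {}" unfolding h_img C_def by auto
        show "0 < h k" if "k < n - m" for k using h_img that unfolding C_def by fastforce
        show "j < n - m" using that j unfolding m_def by linarith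
      qed (use j in \<open>auto simp: m_def\<close>)
    qed
    ultimately show ?thesis using monic_at_Var_diff[of "2 * j < n" "i j" "h j"] by auto
  qed
  have "sqfree (i ` {1..n div 2}) = (\<Sum>j=1..n div 2. Poly_Mapping.single (i j) 1)"
    unfolding sqfree_def using ballot_seq_inj[OF i] by (simp add: sum.reindex m_def)
  moreover have "monic_at (\<Sum>j=1..n div 2. Poly_Mapping.single (i j) 1) (spec_poly n \<sigma> :: 'a mpoly)"
    unfolding spec_poly_def by (rule monic_at_prod[OF _ factor]) simp_all
  ultimately have "monic_at (sqfree (i ` {1..n div 2})) (spec_poly n \<sigma> :: 'a mpoly)" by simp
  with perm show ?thesis by blast
qed

section \<open>Ideals determined by leading monomials\<close>

lemma lookup_le_mono_degree: "Poly_Mapping.lookup t i \<le> mono_degree t"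
  by (cases "i \<in> Poly_Mapping.keys t") (auto simp: mono_degree_def Poly_Mapping.in_keys_iff intro: member_le_sum)

text \<open>The order is graded, so only monomials of bounded degree lie below \<open>t\<close>. This makes the division
  algorithm terminate.\<close>
lemma finite_below: "finite {u. Poly_Mapping.keys u \<subseteq> {1..n} \<and> grevlex_less u t}"
proof -
  let ?F = "{f. \<forall>x. (x \<in> {1..n} \<longrightarrow> f x \<in> {..mono_degree t}) \<and> (x \<notin> {1..n} \<longrightarrow> f x = (0::nat))}"
  have "Poly_Mapping.lookup ` {u. Poly_Mapping.keys u \<subseteq> {1..n} \<and> grevlex_less u t} \<subseteq> ?F"
  proof (intro image_subsetI CollectI allI conjI impI)
    fix u i assume u: "u \<in> {u. Poly_Mapping.keys u \<subseteq> {1..n} \<and> grevlex_less u t}"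
    then have "mono_degree u \<le> mono_degree t" by (auto simp: grevlex_less_def)
    then show "Poly_Mapping.lookup u i \<in> {..mono_degree t}" using lookup_le_mono_degree[of u i] by simp
    show "Poly_Mapping.lookup u i = 0" if "i \<notin> {1..n}" using u that by (auto simp: Poly_Mapping.in_keys_iff)
  qed
  moreover have "finite ?F" by (rule finite_set_of_finite_funs) auto
  ultimately have "finite (Poly_Mapping.lookup ` {u. Poly_Mapping.keys u \<subseteq> {1..n} \<and> grevlex_less u t})"
    by (rule finite_subset)
  then show ?thesis by (rule finite_imageD) (simp add: inj_on_def Poly_Mapping.lookup_inject)
qed

text \<open>The division algorithm: subtracting a scalar multiple of an element of \<open>I\<close> with the same leading
  monomial lowers the leading monomial without leaving \<open>G\<close>.\<close>
lemma ideal_subset_if_leads: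
  fixes I G :: "'a::field mpoly set"
  assumes I: "ideal I (mpoly_ring n)" and G: "ideal G (mpoly_ring n)" and "I \<subseteq> G"
    and leads: "\<And>f. f \<in> G \<Longrightarrow> f \<noteq> 0 \<Longrightarrow> \<exists>g\<in>I. g \<noteq> 0 \<and> lead_monomial g = lead_monomial f"
  shows "G \<subseteq> I"
proof
  fix f assume "f \<in> G"
  then show "f \<in> I"
  proof (induction "card {u. Poly_Mapping.keys u \<subseteq> {1..n} \<and> grevlex_less u (lead_monomial f)}"
      arbitrary: f rule: less_induct)
    case less
    show ?case
    proof (cases "f = 0")
      case True
      then show ?thesis using ideal_mpolyD(2)[OF I] by simp
    next
      case False
      let ?t = "lead_monomial f"
      obtain g where g: "g \<in> I" "g \<noteq> 0" "lead_monomial g = ?t"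
        using leads[OF less.prems False] by blast
      define c where "c = Poly_Mapping.lookup f ?t / Poly_Mapping.lookup g ?t"
      define h where "h = f - Poly_Mapping.single 0 c * g"
      have g_lead: "Poly_Mapping.lookup g ?t \<noteq> 0"
        using lead_monomial_props(1)[OF g(2)] g(3) by (simp add: Poly_Mapping.in_keys_iff)
      have lookup_cg: "Poly_Mapping.lookup (Poly_Mapping.single 0 c * g) u = c * Poly_Mapping.lookup g u" for u
        using lookup_times_single[of g 0 c u] by (simp add: mult.commute)
      have cg: "Poly_Mapping.single 0 c * g \<in> I"
        using g(1) by (intro ideal_mpolyD(4)[OF I] single_carrier) auto
      then have h: "h \<in> G"
        unfolding h_def using less.prems \<open>I \<subseteq> G\<close> by (intro ideal_mpolyD(6)[OF G]) auto
      have "h \<in> I"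
      proof (cases "h = 0")
        case True
        then show ?thesis using ideal_mpolyD(2)[OF I] by simp
      next
        case h0: False
        let ?u = "lead_monomial h"
        have "?u \<in> Poly_Mapping.keys h" by (rule lead_monomial_props(1)[OF h0])
        moreover have "Poly_Mapping.lookup h u = Poly_Mapping.lookup f u - c * Poly_Mapping.lookup g u" for u
          by (simp add: h_def Poly_Mapping.lookup_minus lookup_cg)
        moreover have "Poly_Mapping.lookup f ?t - c * Poly_Mapping.lookup g ?t = 0" using g_lead by (simp add: c_def)
        ultimately have "?u \<noteq> ?t" "?u \<in> Poly_Mapping.keys f \<or> ?u \<in> Poly_Mapping.keys g"
          by (auto simp: Poly_Mapping.in_keys_iff)
        then have less_t: "grevlex_less ?u ?t"
          using lead_monomial_props(2)[OF False] lead_monomial_props(2)[OF g(2)] g(3) by auto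
        have "Poly_Mapping.keys ?u \<subseteq> {1..n}"
          using \<open>?u \<in> Poly_Mapping.keys h\<close> ideal_mpolyD(1)[OF G] h in_carrier_mpoly_ring by blast
        then have "{u. Poly_Mapping.keys u \<subseteq> {1..n} \<and> grevlex_less u ?u} \<subset>
            {u. Poly_Mapping.keys u \<subseteq> {1..n} \<and> grevlex_less u ?t}"
          using less_t grevlex_less_trans[of _ ?u ?t] grevlex_less_irrefl[of ?u] by blast
        then show ?thesis
          using h by (intro less.hyps psubset_card_mono finite_below)
      qed
      then have "h + Poly_Mapping.single 0 c * g \<in> I" using cg by (rule ideal_mpolyD(3)[OF I])
      then show ?thesis by (simp add: h_def)
    qed
  qed
qed

lemma lead_ideal_ideal:
  assumes "S \<subseteq> carrier (mpoly_ring n)"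
  shows "ideal (lead_ideal n S) (mpoly_ring n :: 'a::comm_ring_1 mpoly ring)"
    and "\<And>f. f \<in> S \<Longrightarrow> f \<noteq> 0 \<Longrightarrow> Poly_Mapping.single (lead_monomial f) 1 \<in> lead_ideal n S"
proof -
  have gens: "{Poly_Mapping.single (lead_monomial f) 1 | f. f \<in> S \<and> f \<noteq> 0} \<subseteq>
      carrier (mpoly_ring n :: 'a mpoly ring)"
  proof
    fix p :: "'a mpoly" assume "p \<in> {Poly_Mapping.single (lead_monomial f) 1 | f. f \<in> S \<and> f \<noteq> 0}"
    then obtain f where f: "p = Poly_Mapping.single (lead_monomial f) 1" "f \<in> S" "f \<noteq> 0" by blast
    then have "Poly_Mapping.keys (lead_monomial f) \<subseteq> {1..n}"
      using lead_monomial_props(1)[OF f(3)] assms f(2) in_carrier_mpoly_ring by blast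
    then show "p \<in> carrier (mpoly_ring n)" unfolding f(1) by (rule single_carrier)
  qed
  show "ideal (lead_ideal n S) (mpoly_ring n)" unfolding lead_ideal_def by (rule Idl_ideal[OF gens])
  show "Poly_Mapping.single (lead_monomial f) 1 \<in> lead_ideal n S" if "f \<in> S" "f \<noteq> 0" for f
    using Idl_self[OF gens] that unfolding lead_ideal_def by blast
qed

lemma lead_ideal_mono:
  assumes "S \<subseteq> S'" "S' \<subseteq> carrier (mpoly_ring n)"
  shows "lead_ideal n S \<subseteq> (lead_ideal n S' :: 'a::comm_ring_1 mpoly set)"
  unfolding lead_ideal_def[of n S]
  by (rule Idl_minimal[OF lead_ideal_ideal(1)[OF assms(2)]])
    (use assms lead_ideal_ideal(2)[OF assms(2)] in blast)

section \<open>Degrees of minimal generators\<close>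

definition hom_part :: "nat \<Rightarrow> 'a::comm_ring_1 mpoly \<Rightarrow> 'a mpoly" where
  "hom_part d f = (\<Sum>t | t \<in> Poly_Mapping.keys f \<and> mono_degree t = d. Poly_Mapping.single t (Poly_Mapping.lookup f t))"

lemma lookup_hom_part:
  "Poly_Mapping.lookup (hom_part d f) t = (if mono_degree t = d then Poly_Mapping.lookup f t else 0)"
  by (simp add: hom_part_def Poly_Mapping.lookup_sum Poly_Mapping.lookup_single when_def Poly_Mapping.in_keys_iff)

lemma hom_part_add: "hom_part d (f + g) = hom_part d f + hom_part d g"
  by (rule poly_mapping_eqI) (simp add: lookup_hom_part Poly_Mapping.lookup_add)

lemma hom_part_0 [simp]: "hom_part d 0 = 0"
  by (simp add: hom_part_def)

lemma hom_part_sum: "hom_part d (\<Sum>i\<in>A. f i) = (\<Sum>i\<in>A. hom_part d (f i))"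
  by (rule poly_mapping_eqI) (simp add: lookup_hom_part Poly_Mapping.lookup_sum)

text \<open>Multiplication by a monomial shifts the grading.\<close>
lemma hom_part_times_single:
  "hom_part d (f * Poly_Mapping.single u c) =
    (if mono_degree u \<le> d then hom_part (d - mono_degree u) f * Poly_Mapping.single u c else 0)"
proof (rule poly_mapping_eqI)
  fix t
  show "Poly_Mapping.lookup (hom_part d (f * Poly_Mapping.single u c)) t = Poly_Mapping.lookup
    (if mono_degree u \<le> d then hom_part (d - mono_degree u) f * Poly_Mapping.single u c else 0) t"
  proof (cases "\<exists>v. t = v + u")
    case True
    then obtain v where "t = v + u" by blast
    then show ?thesis by (auto simp: lookup_hom_part lookup_times_single mono_degree_add)
  next
    case False
    then show ?thesis by (simp add: lookup_hom_part lookup_times_single_eq_0)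
  qed
qed

lemma hom_part_form: "is_form e f \<Longrightarrow> hom_part d f = (if d = e then f else 0)"
  by (rule poly_mapping_eqI) (auto simp: lookup_hom_part is_form_def Poly_Mapping.in_keys_iff)

lemma homogeneous_form: "homogeneous f \<Longrightarrow> is_form (mpoly_degree f) f"
  by (simp add: homogeneous_def is_form_def)

lemma form_degree:
  assumes "is_form d f" "f \<noteq> 0" shows "mpoly_degree f = d" "homogeneous f"
proof -
  have "Poly_Mapping.keys f \<noteq> {}" using assms(2) by simp
  then obtain t where "t \<in> Poly_Mapping.keys f" by blast
  then have "mono_degree ` Poly_Mapping.keys f = {d}"
    using assms(1) by (auto simp: is_form_def image_iff)
  then show "mpoly_degree f = d" by (simp add: mpoly_degree_def)
  then show "homogeneous f" using assms by (simp add: homogeneous_def is_form_def)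
qed

text \<open>In a combination of homogeneous generators only the parts of degree \<open>d\<close> contribute to a form of
  degree \<open>d\<close>, and generators of larger degree have none. Formally, the polynomials all of whose
  homogeneous parts lie in the ideals generated in the appropriate degrees form an ideal that
  contains \<open>M\<close>.\<close>
lemma form_in_Idl_low_degree:
  fixes M :: "'a::comm_ring_1 mpoly set"
  assumes M: "M \<subseteq> carrier (mpoly_ring n)" "\<And>f. f \<in> M \<Longrightarrow> homogeneous f"
    and f: "f \<in> Idl\<^bsub>mpoly_ring n\<^esub> M" "is_form d f"
  shows "f \<in> Idl\<^bsub>mpoly_ring n\<^esub> {g \<in> M. \<exists>e\<le>d. is_form e g}"
proof -
  let ?I = "\<lambda>d. Idl\<^bsub>mpoly_ring n\<^esub> {g \<in> M. \<exists>e\<le>d. is_form e g}"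
  let ?K = "{f \<in> carrier (mpoly_ring n). \<forall>d. hom_part d f \<in> ?I d}"
  have gens: "{g \<in> M. \<exists>e\<le>d. is_form e g} \<subseteq> carrier (mpoly_ring n)" for d using M(1) by auto
  note I = Idl_ideal[OF gens]
  have mono: "?I d \<subseteq> ?I e" if "d \<le> e" for d e
    using that by (intro Idl_mono gens) (auto intro: order_trans)
  have "ideal ?K (mpoly_ring n)"
  proof (rule ideal_mpolyI)
    show "0 \<in> ?K" using ideal_mpolyD(2)[OF I] by (simp add: carrier_mpoly_0)
    show "f + g \<in> ?K" if "f \<in> ?K" "g \<in> ?K" for f g
      using that ideal_mpolyD(3)[OF I] by (simp add: hom_part_add carrier_mpoly_add)
    show "a * f \<in> ?K" if a: "a \<in> carrier (mpoly_ring n)" and f: "f \<in> ?K" for a f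
    proof (intro CollectI conjI allI)
      show "a * f \<in> carrier (mpoly_ring n)" using a f by (simp add: carrier_mpoly_mult)
      fix d
      have "a * f = (\<Sum>m\<in>Poly_Mapping.keys a. f * Poly_Mapping.single m (Poly_Mapping.lookup a m))"
        by (subst mpoly_sum_monomials[of a]) (simp add: sum_distrib_left mult.commute)
      then have "hom_part d (a * f) = (\<Sum>m\<in>Poly_Mapping.keys a. hom_part d (f * Poly_Mapping.single m (Poly_Mapping.lookup a m)))"
        by (simp only: hom_part_sum)
      also have "\<dots> \<in> ?I d"
      proof (rule ideal_mpoly_sum[OF I])
        fix m assume "m \<in> Poly_Mapping.keys a"
        then have "Poly_Mapping.single m (Poly_Mapping.lookup a m) \<in> carrier (mpoly_ring n)"
          using a by (intro single_carrier) (auto simp: in_carrier_mpoly_ring)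
        moreover have "hom_part (d - mono_degree m) f \<in> ?I d"
          using f mono[of "d - mono_degree m" d] by auto
        ultimately show "hom_part d (f * Poly_Mapping.single m (Poly_Mapping.lookup a m)) \<in> ?I d"
          using ideal_mpolyD(2,5)[OF I] by (simp add: hom_part_times_single)
      qed
      finally show "hom_part d (a * f) \<in> ?I d" .
    qed
  qed auto
  moreover have "M \<subseteq> ?K"
  proof
    fix g assume g: "g \<in> M"
    then have form: "is_form (mpoly_degree g) g" using M(2) homogeneous_form by blast
    have "hom_part d g \<in> ?I d" for d
      using hom_part_form[OF form, of d] Idl_self[OF gens, of d] ideal_mpolyD(2)[OF I] g form by auto
    then show "g \<in> ?K" using g M(1) by auto
  qed
  ultimately have "f \<in> ?K" using Idl_minimal f(1) by blast
  then have "hom_part d f \<in> ?I d" by blast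
  then show ?thesis using hom_part_form[OF f(2), of d] by simp
qed

lemma minimal_generators_nonzero:
  assumes "minimal_generators n M I" shows "0 \<notin> M"
proof
  assume "0 \<in> M"
  have M: "M \<subseteq> carrier (mpoly_ring n)" using assms by (simp add: minimal_generators_def)
  then have M': "M - {0} \<subseteq> carrier (mpoly_ring n)" by auto
  have "M \<subseteq> Idl\<^bsub>mpoly_ring n\<^esub> (M - {0})"
    using Idl_self[OF M'] ideal_mpolyD(2)[OF Idl_ideal[OF M']] by auto
  then have "Idl\<^bsub>mpoly_ring n\<^esub> (M - {0}) = Idl\<^bsub>mpoly_ring n\<^esub> M"
    using Idl_minimal[OF Idl_ideal[OF M']] Idl_mono[OF _ M, of "M - {0}"] by blast
  moreover have "M - {0} \<subset> M" using \<open>0 \<in> M\<close> by blast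
  ultimately show False using assms by (auto simp: minimal_generators_def)
qed

definition lower_forms :: "'a::comm_ring_1 mpoly set \<Rightarrow> nat \<Rightarrow> 'a mpoly set" where
  "lower_forms I d = {g \<in> I. \<exists>e<d. is_form e g}"

text \<open>The right-hand side does not mention \<open>M\<close>: the degrees of the minimal generators are an invariant
  of the ideal. A generator that is a combination of elements of lower degree could be dropped; and
  a form that is not such a combination needs a generator of its own degree.\<close>
lemma minimal_generators_degrees:
  fixes I :: "'a::comm_ring_1 mpoly set"
  assumes min: "minimal_generators n M I"
  shows "mpoly_degree ` M =
    {d. \<exists>f\<in>I. is_form d f \<and> f \<notin> Idl\<^bsub>mpoly_ring n\<^esub> (lower_forms I d)}"
proof -
  have M: "M \<subseteq> carrier (mpoly_ring n)" and hom: "\<And>f. f \<in> M \<Longrightarrow> homogeneous f"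
    and Idl: "Idl\<^bsub>mpoly_ring n\<^esub> M = I"
    and minimal: "\<And>M'. M' \<subset> M \<Longrightarrow> Idl\<^bsub>mpoly_ring n\<^esub> M' \<noteq> I"
    using min by (auto simp: minimal_generators_def)
  have I: "ideal I (mpoly_ring n)" using Idl_ideal[OF M] Idl by simp
  have MI: "M \<subseteq> I" using Idl_self[OF M] Idl by simp
  have low: "lower_forms I d \<subseteq> carrier (mpoly_ring n)" for d
    using ideal_mpolyD(1)[OF I] by (auto simp: lower_forms_def)
  have nonzero: "f \<noteq> 0" if "f \<in> M" for f using minimal_generators_nonzero[OF min] that by auto
  have deg: "e = mpoly_degree f" if "f \<in> M" "is_form e f" for e f
    using form_degree[OF that(2) nonzero[OF that(1)]] by simp
  show ?thesis
  proof (intro equalityI subsetI)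
    fix d assume "d \<in> mpoly_degree ` M"
    then obtain f where f: "f \<in> M" "d = mpoly_degree f" by blast
    have M': "M - {f} \<subseteq> carrier (mpoly_ring n)" using M by auto
    have "f \<notin> Idl\<^bsub>mpoly_ring n\<^esub> (lower_forms I d)"
    proof
      assume f_low: "f \<in> Idl\<^bsub>mpoly_ring n\<^esub> (lower_forms I d)"
      have "lower_forms I d \<subseteq> Idl\<^bsub>mpoly_ring n\<^esub> (M - {f})"
      proof
        fix g assume "g \<in> lower_forms I d"
        then obtain e where e: "g \<in> I" "e < d" "is_form e g" by (auto simp: lower_forms_def)
        have "g \<in> Idl\<^bsub>mpoly_ring n\<^esub> {h \<in> M. \<exists>e'\<le>e. is_form e' h}"
          by (rule form_in_Idl_low_degree[OF M hom]) (use e Idl in auto)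
        moreover have "{h \<in> M. \<exists>e'\<le>e. is_form e' h} \<subseteq> M - {f}" using deg f e(2) by fastforce
        ultimately show "g \<in> Idl\<^bsub>mpoly_ring n\<^esub> (M - {f})" using Idl_mono[OF _ M'] by blast
      qed
      then have "f \<in> Idl\<^bsub>mpoly_ring n\<^esub> (M - {f})"
        using f_low Idl_minimal[OF Idl_ideal[OF M']] by blast
      then have "M \<subseteq> Idl\<^bsub>mpoly_ring n\<^esub> (M - {f})" using Idl_self[OF M'] by blast
      then have "I \<subseteq> Idl\<^bsub>mpoly_ring n\<^esub> (M - {f})"
        using Idl_minimal[OF Idl_ideal[OF M']] Idl by blast
      moreover have "Idl\<^bsub>mpoly_ring n\<^esub> (M - {f}) \<subseteq> I" using Idl_mono[OF _ M, of "M - {f}"] Idl by blast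
      ultimately show False using minimal[of "M - {f}"] f(1) by blast
    qed
    then show "d \<in> {d. \<exists>f\<in>I. is_form d f \<and> f \<notin> Idl\<^bsub>mpoly_ring n\<^esub> (lower_forms I d)}"
      using f MI hom homogeneous_form by blast
  next
    fix d assume "d \<in> {d. \<exists>f\<in>I. is_form d f \<and> f \<notin> Idl\<^bsub>mpoly_ring n\<^esub> (lower_forms I d)}"
    then obtain f where f: "f \<in> I" "is_form d f" "f \<notin> Idl\<^bsub>mpoly_ring n\<^esub> (lower_forms I d)" by blast
    show "d \<in> mpoly_degree ` M"
    proof (rule ccontr)
      assume d: "d \<notin> mpoly_degree ` M"
      have "f \<in> Idl\<^bsub>mpoly_ring n\<^esub> {g \<in> M. \<exists>e\<le>d. is_form e g}"
        by (rule form_in_Idl_low_degree[OF M hom]) (use f Idl in auto)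
      moreover have "{g \<in> M. \<exists>e\<le>d. is_form e g} \<subseteq> lower_forms I d"
      proof
        fix g assume "g \<in> {g \<in> M. \<exists>e\<le>d. is_form e g}"
        then obtain e where e: "g \<in> M" "e \<le> d" "is_form e g" by blast
        then have "e \<noteq> d" using deg d by blast
        then show "g \<in> lower_forms I d" using e MI unfolding lower_forms_def by (auto intro!: exI[of _ e])
      qed
      ultimately show False using f(3) Idl_mono[OF _ low] by blast
    qed
  qed
qed

lemma exists_minimal_generators:
  assumes "finite S" "S \<subseteq> carrier (mpoly_ring n)" "\<And>f. f \<in> S \<Longrightarrow> homogeneous f"
    and "Idl\<^bsub>mpoly_ring n\<^esub> S = (I :: 'a::comm_ring_1 mpoly set)"
  shows "\<exists>M. finite M \<and> minimal_generators n M I"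
proof -
  let ?A = "{M. M \<subseteq> S \<and> Idl\<^bsub>mpoly_ring n\<^esub> M = I}"
  have "finite ?A" using assms(1) by simp
  moreover have "?A \<noteq> {}" using assms(4) by blast
  ultimately obtain M where M: "M \<in> ?A" "\<forall>M'\<in>?A. M' \<subseteq> M \<longrightarrow> M = M'"
    using finite_has_minimal[of ?A] by blast
  have "minimal_generators n M I"
    unfolding minimal_generators_def
  proof (intro conjI ballI allI impI)
    show "M \<subseteq> carrier (mpoly_ring n)" "Idl\<^bsub>mpoly_ring n\<^esub> M = I" using M(1) assms(2) by auto
    show "homogeneous f" if "f \<in> M" for f using that M(1) assms(3) by blast
    show "Idl\<^bsub>mpoly_ring n\<^esub> M' \<noteq> I" if "M' \<subset> M" for M' using that M by blast
  qed
  moreover have "finite M" using M(1) assms(1) finite_subset by auto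
  ultimately show ?thesis by blast
qed

section \<open>Permuted generators and ballot monomials\<close>

definition spec_polys :: "nat \<Rightarrow> 'a::comm_ring_1 mpoly set" where
  "spec_polys n = {spec_poly n \<sigma> | \<sigma>. \<sigma> permutes {1..n}}"

definition ballot_monomials :: "nat \<Rightarrow> 'a::comm_ring_1 mpoly set" where
  "ballot_monomials n = {Poly_Mapping.single (sqfree (i ` {1..n div 2})) 1 | i. ballot_seq (n div 2) i}"

lemma prod_Var:
  assumes "inj_on i A" "finite A"
  shows "(\<Prod>j\<in>A. Var (i j)) = (Poly_Mapping.single (sqfree (i ` A)) 1 :: 'a::comm_ring_1 mpoly)"
  using assms(2,1)
proof (induction A)
  case empty
  then show ?case by (simp add: sqfree_def)
next
  case (insert x A)
  then show ?case by (simp add: sqfree_def Poly_Mapping.mult_single Var_def)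
qed

lemma ballot_monomials_eq:
  assumes "n \<ge> 2"
  shows "ballot_monomials n = {\<Prod>j=1..(n - 2) div 2 + 1. Var (i j) | i :: nat \<Rightarrow> nat.
    0 < i 1 \<and> strict_mono_on {1..(n - 2) div 2 + 1} i \<and> (\<forall>j\<in>{1..(n - 2) div 2 + 1}. i j \<le> 2 * j)}"
proof -
  have m: "(n - 2) div 2 + 1 = n div 2" using assms by simp
  have "(\<Prod>j=1..n div 2. Var (i j)) = (Poly_Mapping.single (sqfree (i ` {1..n div 2})) 1 :: 'a mpoly)"
    if "ballot_seq (n div 2) i" for i
    using prod_Var[OF ballot_seq_inj[OF that]] by simp
  then show ?thesis unfolding m ballot_monomials_def ballot_seq_def[symmetric]
    by (intro Collect_cong) metis
qed

lemma spec_polys_carrier: "spec_polys n \<subseteq> carrier (mpoly_ring n :: 'a::comm_ring_1 mpoly ring)"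
  using spec_poly_carrier unfolding spec_polys_def by blast

lemma finite_spec_polys: "finite (spec_polys n :: 'a::comm_ring_1 mpoly set)"
proof -
  have "(spec_polys n :: 'a mpoly set) = spec_poly n ` {\<sigma>. \<sigma> permutes {1..n}}" unfolding spec_polys_def by blast
  then show ?thesis using finite_permutations[of "{1..n}"] by simp
qed

lemma ballot_monomials_carrier:
  "ballot_monomials n \<subseteq> carrier (mpoly_ring n :: 'a::comm_ring_1 mpoly ring)"
proof -
  have "Poly_Mapping.single (sqfree (i ` {1..n div 2})) 1 \<in> carrier (mpoly_ring n :: 'a mpoly ring)"
    if "ballot_seq (n div 2) i" for i
    using ballot_seq_image[OF that] by (intro single_carrier) (simp add: keys_sqfree)
  then show ?thesis unfolding ballot_monomials_def by blast
qed

lemma sym_ideal_spec_poly: "sym_ideal n (spec_poly n id) = Idl\<^bsub>mpoly_ring n\<^esub> (spec_polys n)"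
  unfolding sym_ideal_def spec_polys_def perm_act_spec_poly ..

lemma degree_one_monomial:
  assumes "mono_degree t = 1" shows "\<exists>i. Poly_Mapping.keys t = {i} \<and> t = sqfree {i}"
proof -
  have "Poly_Mapping.lookup t i \<le> 1" for i using lookup_le_mono_degree[of t i] assms by simp
  then have t: "t = sqfree (Poly_Mapping.keys t)" by (rule sqfree_eqI)
  then have "card (Poly_Mapping.keys t) = 1" using assms mono_degree_sqfree[of "Poly_Mapping.keys t"] by simp
  then show ?thesis using t by (metis card_1_singletonE)
qed

lemma squares_low_form:
  assumes "f \<in> squares n" "is_form e f" "e < 2" shows "f = 0"
proof (rule ccontr)
  assume "f \<noteq> 0"
  then have "Poly_Mapping.keys f \<noteq> {}" by simp
  then obtain t where t: "t \<in> Poly_Mapping.keys f" by blast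
  then obtain i where "Poly_Mapping.lookup t i \<ge> 2" using assms(1) unfolding squares_ideal by blast
  then have "mono_degree t \<ge> 2" using lookup_le_mono_degree[of t i] by linarith
  then show False using assms t by (auto simp: is_form_def)
qed

lemma Var_square_form: "is_form 2 (Var i ^ 2 :: 'a::comm_ring_1 mpoly)"
  by (simp add: is_form_def Var_square)

section \<open>The colon ideal of the squared sum\<close>

locale square_colon =
  fixes n :: nat and G :: "'k::field mpoly set"
  assumes n: "n \<ge> 2" and char: "\<And>m. 0 < m \<Longrightarrow> m \<le> n \<Longrightarrow> (of_nat m :: 'k) \<noteq> 0"
    and G: "G = colon (mpoly_ring n) (squares n) ((\<Sum>i=1..n. Var i) ^ 2)"
begin

lemma in_G_iff:
  "f \<in> G \<longleftrightarrow> f \<in> carrier (mpoly_ring n) \<and> f * (\<Sum>i=1..n. Var i) ^ 2 \<in> squares n"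
  by (simp add: G colon_def)

lemma G_ideal: "ideal G (mpoly_ring n)"
proof (rule ideal_mpolyI)
  note J = squares_is_ideal[of n, where 'a = 'k]
  show "G \<subseteq> carrier (mpoly_ring n)" using in_G_iff by blast
  show "0 \<in> G" using ideal_mpolyD(2)[OF J] by (simp add: in_G_iff carrier_mpoly_0)
  show "f + g \<in> G" if "f \<in> G" "g \<in> G" for f g
    using that ideal_mpolyD(3)[OF J] by (simp add: in_G_iff carrier_mpoly_add distrib_right)
  show "a * f \<in> G" if "a \<in> carrier (mpoly_ring n)" "f \<in> G" for a f
    using that ideal_mpolyD(4)[OF J] by (simp add: in_G_iff carrier_mpoly_mult mult.assoc)
qed

lemma squares_subset_G: "squares n \<subseteq> G"
proof
  fix f :: "'k mpoly" assume f: "f \<in> squares n"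
  note J = squares_is_ideal[of n, where 'a = 'k]
  have "(\<Sum>i=1..n. Var i :: 'k mpoly) ^ 2 \<in> carrier (mpoly_ring n)"
    by (intro carrier_mpoly_power carrier_mpoly_sum Var_carrier)
  then show "f \<in> G" using f ideal_mpolyD(1,5)[OF J] by (auto simp: in_G_iff)
qed

lemma spec_polys_subset_G: "spec_polys n \<subseteq> G"
  using spec_poly_colon[OF _ n] spec_poly_carrier in_G_iff unfolding spec_polys_def by blast

definition spec_ideal :: "'k mpoly set" where
  "spec_ideal = squares n <+>\<^bsub>mpoly_ring n\<^esub> Idl\<^bsub>mpoly_ring n\<^esub> (spec_polys n)"

lemma spec_ideal_ideal: "ideal spec_ideal (mpoly_ring n)"
  unfolding spec_ideal_def
  by (intro ideal_sum_ideal squares_is_ideal Idl_ideal spec_polys_carrier)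

lemma spec_ideal_gens: "squares n \<subseteq> spec_ideal" "spec_polys n \<subseteq> spec_ideal"
proof -
  have "squares n \<subseteq> spec_ideal" "Idl\<^bsub>mpoly_ring n\<^esub> (spec_polys n) \<subseteq> spec_ideal"
    using ideal_sum_subset_iff[OF squares_is_ideal Idl_ideal[OF spec_polys_carrier] spec_ideal_ideal]
    unfolding spec_ideal_def by auto
  then show "squares n \<subseteq> spec_ideal" "spec_polys n \<subseteq> spec_ideal"
    using Idl_self[OF spec_polys_carrier] by blast+
qed

lemma spec_ideal_subset_G: "spec_ideal \<subseteq> G"
  unfolding spec_ideal_def
  using ideal_sum_subset_iff[OF squares_is_ideal Idl_ideal[OF spec_polys_carrier] G_ideal]
    squares_subset_G Idl_minimal[OF G_ideal spec_polys_subset_G] by blast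

text \<open>Either way the leading monomial is a multiple of one that is realized by an element of the ideal
  generated by the squares and the permuted generators.\<close>
lemma lead_cases:
  assumes "f \<in> G" "f \<noteq> 0"
  obtains v i where "i \<in> {1..n}" "Poly_Mapping.keys v \<subseteq> {1..n}" "lead_monomial f = v + Poly_Mapping.single i 2"
  | v i where "ballot_seq (n div 2) i" "Poly_Mapping.keys v \<subseteq> {1..n}"
      "lead_monomial f = v + sqfree (i ` {1..n div 2})"
proof -
  have f: "f \<in> carrier (mpoly_ring n)" using assms in_G_iff by blast
  have keys: "Poly_Mapping.keys (lead_monomial f) \<subseteq> {1..n}"
    using f lead_monomial_props(1)[OF assms(2)] in_carrier_mpoly_ring by blast
  consider i where "Poly_Mapping.lookup (lead_monomial f) i \<ge> 2"
    | i v where "ballot_seq (n div 2) i" "Poly_Mapping.keys v \<subseteq> {1..n}"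
      "lead_monomial f = v + sqfree (i ` {1..n div 2})"
    using colon_lead[OF char n f assms(2)] assms(1) in_G_iff by blast
  then show thesis
  proof cases
    case 1
    then have "i \<in> Poly_Mapping.keys (lead_monomial f)" by (auto simp: Poly_Mapping.in_keys_iff)
    then have "i \<in> {1..n}" using keys by blast
    then show ?thesis using single_square_split[OF 1] keys that(1) by blast
  qed (use that(2) in blast)
qed

lemma lead_in_spec_ideal:
  assumes "f \<in> G" "f \<noteq> 0"
  shows "\<exists>g\<in>spec_ideal. g \<noteq> 0 \<and> lead_monomial g = lead_monomial f"
  using assms
proof (cases rule: lead_cases)
  case (1 v i)
  let ?g = "Poly_Mapping.single v 1 * Var i ^ 2 :: 'k mpoly"
  have "?g \<in> spec_ideal"
    using 1 Var_square_in_squares spec_ideal_gens(1)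
    by (intro ideal_mpolyD(4)[OF spec_ideal_ideal] single_carrier) auto
  moreover have "monic_at (v + Poly_Mapping.single i 2) ?g"
    unfolding Var_square by (intro monic_at_mult monic_at_single)
  ultimately show ?thesis using monic_at_lead 1(3) by metis
next
  case (2 v i)
  obtain \<sigma> where \<sigma>: "\<sigma> permutes {1..n}"
    "monic_at (sqfree (i ` {1..n div 2})) (spec_poly n \<sigma> :: 'k mpoly)"
    using spec_poly_lead[OF 2(1) n] by blast
  let ?g = "Poly_Mapping.single v 1 * spec_poly n \<sigma> :: 'k mpoly"
  have "spec_poly n \<sigma> \<in> spec_ideal" using \<sigma>(1) spec_ideal_gens(2) by (auto simp: spec_polys_def)
  then have "?g \<in> spec_ideal"
    using 2 by (intro ideal_mpolyD(4)[OF spec_ideal_ideal] single_carrier)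
  moreover have "monic_at (v + sqfree (i ` {1..n div 2})) ?g"
    by (intro monic_at_mult monic_at_single \<sigma>(2))
  ultimately show ?thesis using monic_at_lead 2(3) by metis
qed

lemma G_eq_spec_ideal: "G = spec_ideal"
  using ideal_subset_if_leads[OF spec_ideal_ideal G_ideal spec_ideal_subset_G lead_in_spec_ideal]
    spec_ideal_subset_G by blast

lemma lead_ideal_upper:
  "lead_ideal n G \<subseteq> squares n <+>\<^bsub>mpoly_ring n\<^esub> Idl\<^bsub>mpoly_ring n\<^esub> (ballot_monomials n)"
    (is "_ \<subseteq> ?N")
proof -
  note B = Idl_ideal[OF ballot_monomials_carrier, of n, where 'a = 'k]
  have N: "ideal ?N (mpoly_ring n)" by (intro ideal_sum_ideal squares_is_ideal B)
  have sub: "squares n \<subseteq> ?N" "ballot_monomials n \<subseteq> ?N"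
    using ideal_sum_subset_iff[OF squares_is_ideal B N]
      Idl_self[OF ballot_monomials_carrier, of n, where 'a = 'k] by blast+
  have "Poly_Mapping.single (lead_monomial f) 1 \<in> ?N" if "f \<in> G" "f \<noteq> 0" for f
    using that
  proof (cases rule: lead_cases)
    case (1 v i)
    have "Poly_Mapping.single v 1 * Var i ^ 2 \<in> ?N"
      using 1 sub(1) Var_square_in_squares by (intro ideal_mpolyD(4)[OF N] single_carrier) auto
    then show ?thesis by (simp add: 1(3) Var_square Poly_Mapping.mult_single)
  next
    case (2 v i)
    have "Poly_Mapping.single (sqfree (i ` {1..n div 2})) 1 \<in> ?N"
      using 2(1) sub(2) unfolding ballot_monomials_def[of n] by blast
    then have "Poly_Mapping.single v 1 * Poly_Mapping.single (sqfree (i ` {1..n div 2})) 1 \<in> ?N"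
      using 2(2) by (intro ideal_mpolyD(4)[OF N] single_carrier)
    then show ?thesis by (simp add: 2(3) Poly_Mapping.mult_single)
  qed
  then show ?thesis unfolding lead_ideal_def by (intro Idl_minimal[OF N]) blast
qed

text \<open>For \<open>n = 2\<close> the products already have the leading monomials \<open>x\<^sub>1\<close> and \<open>x\<^sub>2\<close>, so that the squares are
  not required in \<open>B\<close>. This is essential: their degree would be wrong.\<close>
lemma lead_ideal_lower:
  fixes B :: "'k mpoly set"
  assumes B: "B \<subseteq> carrier (mpoly_ring n)" "spec_polys n - {0} \<subseteq> B"
    and sq: "n \<ge> 3 \<Longrightarrow> {Var i ^ 2 | i. i \<in> {1..n}} \<subseteq> B"
  shows "squares n <+>\<^bsub>mpoly_ring n\<^esub> Idl\<^bsub>mpoly_ring n\<^esub> (ballot_monomials n) \<subseteq> lead_ideal n B"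
proof -
  note L = lead_ideal_ideal[OF B(1)]
  have mono: "Poly_Mapping.single (sqfree (i ` {1..n div 2})) 1 \<in> lead_ideal n B"
    if i: "ballot_seq (n div 2) i" for i
  proof -
    obtain \<sigma> where \<sigma>: "\<sigma> permutes {1..n}"
      "monic_at (sqfree (i ` {1..n div 2})) (spec_poly n \<sigma> :: 'k mpoly)"
      using spec_poly_lead[OF i n] by blast
    note lead = monic_at_lead[OF \<sigma>(2)]
    have "spec_poly n \<sigma> \<in> (spec_polys n :: 'k mpoly set)" unfolding spec_polys_def using \<sigma>(1) by blast
    then have "spec_poly n \<sigma> \<in> B" using lead(1) B(2) by (simp add: subset_iff)
    from L(2)[OF this lead(1)] show ?thesis by (simp add: lead(2))
  qed
  have square: "Var i ^ 2 \<in> lead_ideal n B" if i: "i \<in> {1..n}" for i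
  proof (cases "n \<ge> 3")
    case True
    have "monic_at (Poly_Mapping.single i 2) (Var i ^ 2 :: 'k mpoly)"
      unfolding Var_square by (rule monic_at_single)
    from monic_at_lead[OF this] L(2)[of "Var i ^ 2"] show ?thesis
      using sq[OF True] i by (auto simp: Var_square)
  next
    case False
    then have "n = 2" using n by simp
    then have "ballot_seq (n div 2) (\<lambda>_. i)"
      using i by (auto simp: ballot_seq_def strict_mono_on_def)
    from mono[OF this] have "Var i \<in> lead_ideal n B"
      using \<open>n = 2\<close> by (simp add: sqfree_def Var_def)
    then show ?thesis using ideal_mpolyD(4)[OF L(1) Var_carrier[OF i]] by (simp add: power2_eq_square)
  qed
  have "squares n \<subseteq> lead_ideal n B" using square by (intro Idl_minimal[OF L(1)]) blast
  moreover have "Idl\<^bsub>mpoly_ring n\<^esub> (ballot_monomials n) \<subseteq> lead_ideal n B"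
    using mono by (intro Idl_minimal[OF L(1)]) (auto simp: ballot_monomials_def)
  ultimately show ?thesis
    using ideal_sum_subset_iff[OF squares_is_ideal Idl_ideal[OF ballot_monomials_carrier] L(1)] by blast
qed

lemma lead_ideal_G:
  "lead_ideal n G = squares n <+>\<^bsub>mpoly_ring n\<^esub> Idl\<^bsub>mpoly_ring n\<^esub> (ballot_monomials n)"
proof (intro equalityI lead_ideal_upper lead_ideal_lower)
  show "G \<subseteq> carrier (mpoly_ring n)" using in_G_iff by blast
  show "spec_polys n - {0} \<subseteq> G" using spec_polys_subset_G by blast
  show "{Var i ^ 2 | i. i \<in> {1..n}} \<subseteq> G"
    using Var_square_in_squares squares_subset_G by blast
qed

lemma low_form:
  assumes "f \<in> G" "is_form d f" "d < n div 2" shows "f \<in> squares n"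
  using colon_low_degree[OF char _ _ assms(2,3)] assms(1) in_G_iff by blast

definition generator_degrees :: "nat set" where
  "generator_degrees = {d. \<exists>f\<in>G. is_form d f \<and> f \<notin> Idl\<^bsub>mpoly_ring n\<^esub> (lower_forms G d)}"

text \<open>In lower degrees the colon ideal agrees with the ideal of squares, which contains no polynomial
  with a squarefree leading monomial.\<close>
lemma half_in_generator_degrees: "n div 2 \<in> generator_degrees"
proof -
  have "ballot_seq (n div 2) (\<lambda>j. j)" by (auto simp: ballot_seq_def strict_mono_on_def)
  from spec_poly_lead[OF this n] obtain \<sigma> where \<sigma>: "\<sigma> permutes {1..n}"
    "monic_at (sqfree {1..n div 2}) (spec_poly n \<sigma> :: 'k mpoly)" by auto
  have "lower_forms G (n div 2) \<subseteq> squares n"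
    using low_form by (auto simp: lower_forms_def)
  then have "Idl\<^bsub>mpoly_ring n\<^esub> (lower_forms G (n div 2)) \<subseteq> squares n"
    by (rule Idl_minimal[OF squares_is_ideal])
  moreover have "spec_poly n \<sigma> \<notin> (squares n :: 'k mpoly set)"
    using lookup_sqfree_squares[of "spec_poly n \<sigma> :: 'k mpoly" n "{1..n div 2}"] \<sigma>(2)
    by (auto simp: monic_at_def)
  moreover have "spec_poly n \<sigma> \<in> G" using \<sigma>(1) spec_polys_subset_G by (auto simp: spec_polys_def)
  ultimately show ?thesis using spec_poly_form unfolding generator_degrees_def by blast
qed

text \<open>Three variables are the only case with \<open>n \<ge> 3\<close> in which \<open>G\<close> contains nonzero linear forms. The
  coefficient of \<open>x\<^sub>1 x\<^sub>2 x\<^sub>3\<close> in \<open>g s\<^sup>2\<close> is twice the sum of the coefficients of \<open>g\<close>.\<close>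
lemma linear_form_sum_zero:
  assumes "n = 3" "g \<in> G" "is_form 1 g"
  shows "subst_mpoly (\<lambda>_. 1) g = (0 :: 'k mpoly)"
proof -
  let ?a = "\<lambda>S. Poly_Mapping.lookup g (sqfree S)"
  let ?A = "(\<lambda>i. sqfree {i}) ` {1, 2, 3}"
  have "t \<in> ?A" if t: "t \<in> Poly_Mapping.keys g" for t
  proof -
    obtain i where i: "Poly_Mapping.keys t = {i}" "t = sqfree {i}"
      using degree_one_monomial[of t] assms(3) t unfolding is_form_def by blast
    then have "i \<in> {1..3}" using assms(1,2) t in_G_iff[of g] in_carrier_mpoly_ring by blast
    then have "i \<in> {1, 2, 3}" by auto
    then show ?thesis using i(2) by blast
  qed
  then have keys: "Poly_Mapping.keys g \<subseteq> ?A" by blast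
  have inj: "inj_on (\<lambda>i. sqfree {i}) {1, 2, 3}"
  proof (rule inj_onI)
    fix i j :: nat assume "sqfree {i} = sqfree {j}"
    then have "Poly_Mapping.keys (sqfree {i}) = Poly_Mapping.keys (sqfree {j})" by simp
    then show "i = j" by (simp add: keys_sqfree)
  qed
  have "subst_mpoly (\<lambda>_. 1) g = (\<Sum>t\<in>?A. Poly_Mapping.single 0 (Poly_Mapping.lookup g t))"
    by (subst subst_mpoly_eq_sum[OF _ keys]) auto
  also have "\<dots> = Poly_Mapping.single 0 (?a {1} + ?a {2} + ?a {3})"
    by (subst sum.reindex[OF inj]) (simp add: Poly_Mapping.single_add add.assoc)
  finally have eq: "subst_mpoly (\<lambda>_. 1) g = Poly_Mapping.single 0 (?a {1} + ?a {2} + ?a {3})" .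
  have "g * (\<Sum>i=1..n. Var i) ^ 2 \<in> squares n" using assms(2) in_G_iff by blast
  then have "(lower_sum ^^ 2) ?a {1, 2, 3} = 0"
    using lookup_times_sum_power[of "{1, 2, 3}" n g 2] assms(1)
      lookup_sqfree_squares[of "g * (\<Sum>i=1..n. Var i) ^ 2" n "{1, 2, 3}"] by simp
  moreover have "(lower_sum ^^ 2) ?a {1, 2, 3} = of_nat 2 * (?a {1} + ?a {2} + ?a {3})"
    by (simp add: numeral_2_eq_2 lower_sum_def insert_Diff_if algebra_simps insert_commute)
  moreover have "(of_nat 2 :: 'k) \<noteq> 0" using char[of 2] n by simp
  ultimately have "?a {1} + ?a {2} + ?a {3} = 0" by (metis mult_eq_0_iff)
  then show ?thesis unfolding eq by simp
qed

text \<open>Evaluation at \<open>x\<^sub>1 = \<dots> = x\<^sub>n = 1\<close> separates \<open>x\<^sub>1\<^sup>2\<close> from the ideal generated by the elements of \<open>G\<close> of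
  degree less than \<open>2\<close>.\<close>
lemma two_in_generator_degrees:
  assumes "n \<ge> 3" shows "2 \<in> generator_degrees"
proof -
  let ?ev = "subst_mpoly (\<lambda>_. 1) :: 'k mpoly \<Rightarrow> 'k mpoly"
  let ?K = "{f \<in> carrier (mpoly_ring n). ?ev f = 0}"
  have "ideal ?K (mpoly_ring n)"
    by (rule ideal_mpolyI)
      (auto simp: subst_mpoly_add subst_mpoly_mult carrier_mpoly_0 carrier_mpoly_add carrier_mpoly_mult)
  moreover have "lower_forms G 2 \<subseteq> ?K"
  proof
    fix g assume "g \<in> lower_forms G 2"
    then obtain e where g: "g \<in> G" "e < 2" "is_form e g" by (auto simp: lower_forms_def)
    have "?ev g = 0"
    proof (cases "e < n div 2")
      case True
      then have "g = 0" using squares_low_form[OF low_form[OF g(1,3)] g(3,2)] by simp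
      then show ?thesis by simp
    next
      case False
      then have "e = 1" "n = 3" using g(2) assms by auto
      then show ?thesis using linear_form_sum_zero g by simp
    qed
    then show "g \<in> ?K" using g in_G_iff by blast
  qed
  ultimately have "Idl\<^bsub>mpoly_ring n\<^esub> (lower_forms G 2) \<subseteq> ?K" by (rule Idl_minimal)
  moreover have "?ev (Var 1 ^ 2) \<noteq> 0" by (simp add: power2_eq_square subst_mpoly_mult)
  moreover have "Var 1 ^ 2 \<in> G" using Var_square_in_squares[of 1 n] squares_subset_G n by auto
  ultimately show ?thesis unfolding generator_degrees_def using Var_square_form by blast
qed

lemma exists_finite_minimal_generators: "\<exists>M. finite M \<and> minimal_generators n M G"
proof (rule exists_minimal_generators)
  let ?S = "{Var i ^ 2 | i. i \<in> {1..n}} \<union> spec_polys n :: 'k mpoly set"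
  have "{Var i ^ 2 | i. i \<in> {1..n}} = (\<lambda>i. Var i ^ 2 :: 'k mpoly) ` {1..n}" by blast
  then show "finite ?S" using finite_spec_polys by simp
  have sub: "?S \<subseteq> G" using Var_square_in_squares squares_subset_G spec_polys_subset_G by blast
  then show S: "?S \<subseteq> carrier (mpoly_ring n)" using in_G_iff by blast
  show "homogeneous f" if "f \<in> ?S" for f
  proof -
    have "is_form 2 f \<or> is_form (n div 2) f"
      using that Var_square_form spec_poly_form unfolding spec_polys_def by blast
    then show ?thesis using form_degree(2) by (cases "f = 0") (auto simp: homogeneous_def)
  qed
  have "squares n \<subseteq> Idl\<^bsub>mpoly_ring n\<^esub> ?S" "Idl\<^bsub>mpoly_ring n\<^esub> (spec_polys n) \<subseteq> Idl\<^bsub>mpoly_ring n\<^esub> ?S"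
    by (intro Idl_mono S; blast)+
  then have "spec_ideal \<subseteq> Idl\<^bsub>mpoly_ring n\<^esub> ?S"
    unfolding spec_ideal_def
    using ideal_sum_subset_iff[OF squares_is_ideal Idl_ideal[OF spec_polys_carrier] Idl_ideal[OF S]]
    by blast
  then show "Idl\<^bsub>mpoly_ring n\<^esub> ?S = G" using G_eq_spec_ideal Idl_minimal[OF G_ideal sub] by blast
qed

text \<open>The elements added to a minimal generating set only have degrees that occur in it anyway. The zero
  polynomial is removed because a Groebner basis must not contain it.\<close>
lemma exists_groebner_basis:
  "\<exists>B. groebner_basis n B G \<and> (\<forall>b\<in>B. homogeneous b) \<and>
    (\<forall>M. minimal_generators n M G \<longrightarrow> mpoly_degree ` B = mpoly_degree ` M)"
proof -
  obtain M where M: "finite M" "minimal_generators n M G"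
    using exists_finite_minimal_generators by blast
  have degrees: "mpoly_degree ` M' = generator_degrees" if "minimal_generators n M' G" for M'
    unfolding generator_degrees_def by (rule minimal_generators_degrees[OF that])
  let ?Q = "if n \<ge> 3 then {Var i ^ 2 | i. i \<in> {1..n}} else {} :: 'k mpoly set"
  let ?B = "(M \<union> spec_polys n \<union> ?Q) - {0}"
  have "{Var i ^ 2 | i. i \<in> {1..n}} = (\<lambda>i. Var i ^ 2 :: 'k mpoly) ` {1..n}" by blast
  then have "finite ?Q" by simp
  then have fin: "finite ?B" using M(1) finite_spec_polys by blast
  have carrier_M: "M \<subseteq> carrier (mpoly_ring n)" "Idl\<^bsub>mpoly_ring n\<^esub> M = G"
    using M(2) by (auto simp: minimal_generators_def)
  have "M \<subseteq> G" using Idl_self[OF carrier_M(1)] carrier_M(2) by simp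
  moreover have "?Q \<subseteq> G" using Var_square_in_squares squares_subset_G by auto
  ultimately have BG: "?B \<subseteq> G" using spec_polys_subset_G by blast
  have G_carrier: "G \<subseteq> carrier (mpoly_ring n)" using in_G_iff by blast
  have "lead_ideal n G \<subseteq> lead_ideal n ?B"
    unfolding lead_ideal_G
  proof (rule lead_ideal_lower)
    show "?B \<subseteq> carrier (mpoly_ring n)" using BG G_carrier by blast
    show "{Var i ^ 2 | i. i \<in> {1..n}} \<subseteq> ?B" if "n \<ge> 3"
      using that monic_at_lead(1)[OF monic_at_single] by (auto simp: Var_square)
  qed blast
  then have "lead_ideal n ?B = lead_ideal n G" using lead_ideal_mono[OF BG G_carrier] by blast
  then have "groebner_basis n ?B G" using fin BG by (simp add: groebner_basis_def)
  moreover have elem: "homogeneous b \<and> mpoly_degree b \<in> generator_degrees" if b: "b \<in> ?B" for b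
  proof -
    have "b \<noteq> 0" using b by simp
    consider "b \<in> M" | "b \<in> spec_polys n" | "b \<in> ?Q" using b by blast
    then show ?thesis
    proof cases
      case 1
      then show ?thesis using M(2) degrees[OF M(2)] by (auto simp: minimal_generators_def)
    next
      case 2
      then have "is_form (n div 2) b" using spec_poly_form unfolding spec_polys_def by blast
      from form_degree[OF this \<open>b \<noteq> 0\<close>] show ?thesis using half_in_generator_degrees by simp
    next
      case 3
      then have "is_form 2 b" "n \<ge> 3" using Var_square_form by (auto split: if_splits)
      from form_degree[OF this(1) \<open>b \<noteq> 0\<close>] show ?thesis
        using two_in_generator_degrees[OF \<open>n \<ge> 3\<close>] by simp
    qed
  qed
  moreover have "mpoly_degree ` ?B = generator_degrees"
  proof
    show "mpoly_degree ` ?B \<subseteq> generator_degrees" using elem by blast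
    have "M \<subseteq> ?B" using minimal_generators_nonzero[OF M(2)] by blast
    then show "generator_degrees \<subseteq> mpoly_degree ` ?B" using degrees[OF M(2)] by blast
  qed
  ultimately show ?thesis using degrees by blast
qed

end

theorem theorem2:
  fixes n l :: nat and J G :: "'k::field mpoly set"
  assumes "n \<ge> 2" and "l = (n - 2) div 2"
    and "CHAR('k) = 0 \<or> CHAR('k) > n"
    and "J = Idl\<^bsub>mpoly_ring n\<^esub> {Var i ^ 2 | i. i \<in> {1..n}}"
    and "G = colon (mpoly_ring n) J ((\<Sum>i=1..n. Var i) ^ 2)"
  shows
    "(odd n \<longrightarrow>
        G = J <+>\<^bsub>mpoly_ring n\<^esub>
              sym_ideal n (\<Prod>j=1..(n - 1) div 2. (Var (2 * j - 1) - Var (2 * j)))) \<and>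
     (even n \<longrightarrow>
        G = J <+>\<^bsub>mpoly_ring n\<^esub>
              sym_ideal n ((\<Prod>j=1..(n - 2) div 2. (Var (2 * j - 1) - Var (2 * j))) * Var (n - 1))) \<and>
     initial_ideal n G =
       J <+>\<^bsub>mpoly_ring n\<^esub>
         Idl\<^bsub>mpoly_ring n\<^esub>
           {\<Prod>j=1..l + 1. Var (i j) | i :: nat \<Rightarrow> nat.
              0 < i 1 \<and> strict_mono_on {1..l + 1} i \<and> (\<forall>j \<in> {1..l + 1}. i j \<le> 2 * j)} \<and>
     (\<exists>M. minimal_generators n M G) \<and>
     (\<exists>B. groebner_basis n B G \<and> (\<forall>b \<in> B. homogeneous b) \<and>
        (\<forall>M. minimal_generators n M G \<longrightarrow> mpoly_degree ` B = mpoly_degree ` M))"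
proof -
  have char: "(of_nat m :: 'k) \<noteq> 0" if "0 < m" "m \<le> n" for m
    using that assms(3) by (auto simp: of_nat_eq_0_iff_char_dvd dest: dvd_imp_le)
  interpret square_colon n G
    using assms(1,4,5) char by unfold_locales auto
  have G: "G = J <+>\<^bsub>mpoly_ring n\<^esub> sym_ideal n (spec_poly n id)"
    unfolding sym_ideal_spec_poly using G_eq_spec_ideal assms(4) by (simp add: spec_ideal_def)
  show ?thesis
  proof (intro conjI impI)
    show "G = J <+>\<^bsub>mpoly_ring n\<^esub>
        sym_ideal n (\<Prod>j=1..(n - 1) div 2. (Var (2 * j - 1) - Var (2 * j)))" if "odd n"
      using G unfolding spec_poly_odd[OF that] .
    show "G = J <+>\<^bsub>mpoly_ring n\<^esub> sym_ideal n
        ((\<Prod>j=1..(n - 2) div 2. (Var (2 * j - 1) - Var (2 * j))) * Var (n - 1))" if "even n"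
      using G unfolding spec_poly_even[OF that assms(1)] .
    show "initial_ideal n G = J <+>\<^bsub>mpoly_ring n\<^esub> Idl\<^bsub>mpoly_ring n\<^esub>
        {\<Prod>j=1..l + 1. Var (i j) | i :: nat \<Rightarrow> nat.
          0 < i 1 \<and> strict_mono_on {1..l + 1} i \<and> (\<forall>j \<in> {1..l + 1}. i j \<le> 2 * j)}"
      unfolding assms(2) ballot_monomials_eq[OF assms(1), symmetric] using lead_ideal_G assms(4) by simp
    show "\<exists>M. minimal_generators n M G" using exists_finite_minimal_generators by blast
  qed (rule exists_groebner_basis)
qed

end
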